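(* If $X_1,\ldots,X_k$ ($k\ge1$) are finitely representable compact metric spaces, then the product space $X_1\times\cdots\times X_k$ is finitely representable.
   Context: Let $\mathcal L$ be a first-order language. A topological $\mathcal L$-structure is a zero-dimensional, compact, Hausdorff, second countable space which is also an $\mathcal L$-structure, with relation symbols interpreted as closed sets and function symbols as continuous functions. An epimorphism between topological $\mathcal L$-structures $A,B$ is a continuous surjection $\varphi:A\to B$ such that $r^B=(\varphi\times\cdots\times\varphi)(r^A)$ for every relation symbol $r$, $f^B(\varphi(a_1),\ldots,\varphi(a_n))=\varphi(f^A(a_1,\ldots,a_n))$ for every $n$-ary function symbol $f$, and $\varphi(c^A)=c^B$ for every constant symbol $c$. An isomorphism is a bijective epimorphism. A family $\mathcal F$ of topological $\mathcal L$-structures is a projective Fraïssé family if (JPP) for all $D,E\in\mathcal F$ there are $F\in\mathcal F$ and epimorphisms $F\to D$, $F\to E$, and (AP) for all $C,D,E\in\mathcal F$ and epimorphisms $\varphi_1:D\to C$, $\varphi_2:E\to C$ there are $F\in\mathcal F$ and epimorphisms $\psi_1:F\to D$, $\psi_2:F\to E$ with $\varphi_1\psi_1=\varphi_2\psi_2$. A topological $\mathcal L$-structure $\mathbb F$ is a projective Fraïssé limit of $\mathcal F$ if (L1) for every $D\in\mathcal F$ there is an epimorphism $\mathbb F\to D$; (L2) for every finite discrete space $A$ and continuous $f:\mathbb F\to A$ there are $D\in\mathcal F$, an epimorphism $\varphi:\mathbb F\to D$ and a function $f':D\to A$ with $f=f'\varphi$; (L3) for every $D\in\mathcal F$ and epimorphisms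 $\varphi_1,\varphi_2:\mathbb F\to D$ there is an isomorphism $\psi:\mathbb F\to\mathbb F$ with $\varphi_2=\varphi_1\psi$. Every non-empty, at most countable projective Fraïssé family of finite topological $\mathcal L$-structures has a projective Fraïssé limit, unique up to isomorphism. For a language $\mathcal L_R$ containing a distinguished binary relation symbol $R$, a compact metric space $X$ is $\mathcal L_R$-representable if there is an at most countable projective Fraïssé family of finite topological $\mathcal L_R$-structures whose projective Fraïssé limit $\mathbb F$ has $R^{\mathbb F}$ an equivalence relation and $\mathbb F/R^{\mathbb F}$ homeomorphic to $X$. $X$ is finitely representable if it is $\mathcal L_R$-representable for some finite such $\mathcal L_R$. *)

theory Defs
  imports "HOL-Analysis.Analysis"
begin

record 's language =
  rel_syms :: "'s set"
  fun_syms :: "'s set"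
  const_syms :: "'s set"
  rel_arity :: "'s \<Rightarrow> nat"
  fun_arity :: "'s \<Rightarrow> nat"

definition language :: "'s language \<Rightarrow> bool" where
  "language L \<longleftrightarrow> (\<forall>r\<in>rel_syms L. rel_arity L r \<ge> 1) \<and> (\<forall>f\<in>fun_syms L. fun_arity L f \<ge> 1)"

definition finite_language :: "'s language \<Rightarrow> bool" where
  "finite_language L \<longleftrightarrow>
     language L \<and> finite (rel_syms L) \<and> finite (fun_syms L) \<and> finite (const_syms L)"

text \<open>An \<open>n\<close>-tuple over \<open>A\<close> is an element of \<open>{..<n} \<rightarrow>\<^sub>E A\<close>, i.e. a point of the product
  topology indexed by \<open>{..<n}\<close>; a map \<open>\<phi>\<close> acts on tuples as \<open>compose {..<n} \<phi>\<close>.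
  Interpretations of symbols outside the language, and values of functions outside the carrier,
  carry no meaning.\<close>

record ('s, 'a) topstruct =
  space_of :: "'a topology"
  rel_of :: "'s \<Rightarrow> (nat \<Rightarrow> 'a) set"
  fun_of :: "'s \<Rightarrow> (nat \<Rightarrow> 'a) \<Rightarrow> 'a"
  const_of :: "'s \<Rightarrow> 'a"

abbreviation carrier_of :: "('s, 'a) topstruct \<Rightarrow> 'a set" where
  "carrier_of A \<equiv> topspace (space_of A)"

abbreviation power_topology :: "nat \<Rightarrow> 'a topology \<Rightarrow> (nat \<Rightarrow> 'a) topology" where
  "power_topology n T \<equiv> product_topology (\<lambda>_. T) {..<n}"

definition topological_structure :: "'s language \<Rightarrow> ('s, 'a) topstruct \<Rightarrow> bool" where
  "topological_structure L A \<longleftrightarrow>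
     space_of A dim_le 0 \<and> compact_space (space_of A) \<and>
     Hausdorff_space (space_of A) \<and> second_countable (space_of A) \<and>
     (\<forall>r\<in>rel_syms L. closedin (power_topology (rel_arity L r) (space_of A)) (rel_of A r)) \<and>
     (\<forall>f\<in>fun_syms L.
        continuous_map (power_topology (fun_arity L f) (space_of A)) (space_of A) (fun_of A f)) \<and>
     (\<forall>c\<in>const_syms L. const_of A c \<in> carrier_of A)"

definition epimorphism ::
    "'s language \<Rightarrow> ('s, 'a) topstruct \<Rightarrow> ('s, 'b) topstruct \<Rightarrow> ('a \<Rightarrow> 'b) \<Rightarrow> bool" where
  "epimorphism L A B \<phi> \<longleftrightarrow>
     continuous_map (space_of A) (space_of B) \<phi> \<and> \<phi> ` carrier_of A = carrier_of B \<and>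
     (\<forall>r\<in>rel_syms L. rel_of B r = compose {..<rel_arity L r} \<phi> ` rel_of A r) \<and>
     (\<forall>f\<in>fun_syms L. \<forall>a \<in> {..<fun_arity L f} \<rightarrow>\<^sub>E carrier_of A.
        fun_of B f (compose {..<fun_arity L f} \<phi> a) = \<phi> (fun_of A f a)) \<and>
     (\<forall>c\<in>const_syms L. \<phi> (const_of A c) = const_of B c)"

definition isomorphism ::
    "'s language \<Rightarrow> ('s, 'a) topstruct \<Rightarrow> ('s, 'b) topstruct \<Rightarrow> ('a \<Rightarrow> 'b) \<Rightarrow> bool" where
  "isomorphism L A B \<phi> \<longleftrightarrow> epimorphism L A B \<phi> \<and> bij_betw \<phi> (carrier_of A) (carrier_of B)"

definition projective_Fraisse_family :: "'s language \<Rightarrow> ('s, 'a) topstruct set \<Rightarrow> bool" where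
  "projective_Fraisse_family L \<F> \<longleftrightarrow>
     (\<forall>D\<in>\<F>. topological_structure L D) \<and>
     (\<forall>D\<in>\<F>. \<forall>E\<in>\<F>. \<exists>F\<in>\<F>. (\<exists>\<phi>. epimorphism L F D \<phi>) \<and> (\<exists>\<phi>. epimorphism L F E \<phi>)) \<and>
     (\<forall>C\<in>\<F>. \<forall>D\<in>\<F>. \<forall>E\<in>\<F>. \<forall>\<phi>\<^sub>1 \<phi>\<^sub>2. epimorphism L D C \<phi>\<^sub>1 \<and> epimorphism L E C \<phi>\<^sub>2 \<longrightarrow>
        (\<exists>F\<in>\<F>. \<exists>\<psi>\<^sub>1 \<psi>\<^sub>2. epimorphism L F D \<psi>\<^sub>1 \<and> epimorphism L F E \<psi>\<^sub>2 \<and>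
           (\<forall>x\<in>carrier_of F. \<phi>\<^sub>1 (\<psi>\<^sub>1 x) = \<phi>\<^sub>2 (\<psi>\<^sub>2 x))))"

text \<open>Finite discrete spaces are represented, up to homeomorphism, by finite sets of naturals.\<close>

definition projective_Fraisse_limit ::
    "'s language \<Rightarrow> ('s, 'a) topstruct set \<Rightarrow> ('s, 'b) topstruct \<Rightarrow> bool" where
  "projective_Fraisse_limit L \<F> M \<longleftrightarrow>
     topological_structure L M \<and>
     (\<forall>D\<in>\<F>. \<exists>\<phi>. epimorphism L M D \<phi>) \<and>
     (\<forall>(A :: nat set) f. finite A \<and> continuous_map (space_of M) (discrete_topology A) f \<longrightarrow>
        (\<exists>D\<in>\<F>. \<exists>\<phi> f'. epimorphism L M D \<phi> \<and> f' ` carrier_of D \<subseteq> A \<and>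
           (\<forall>x\<in>carrier_of M. f x = f' (\<phi> x)))) \<and>
     (\<forall>D\<in>\<F>. \<forall>\<phi>\<^sub>1 \<phi>\<^sub>2. epimorphism L M D \<phi>\<^sub>1 \<and> epimorphism L M D \<phi>\<^sub>2 \<longrightarrow>
        (\<exists>\<psi>. isomorphism L M M \<psi> \<and> (\<forall>x\<in>carrier_of M. \<phi>\<^sub>2 x = \<phi>\<^sub>1 (\<psi> x))))"

definition binary_rel_of :: "('s, 'a) topstruct \<Rightarrow> 's \<Rightarrow> ('a \<times> 'a) set" where
  "binary_rel_of A r = (\<lambda>u. (u 0, u 1)) ` rel_of A r"

definition quotient_topology :: "'a topology \<Rightarrow> ('a \<times> 'a) set \<Rightarrow> 'a set topology" where
  "quotient_topology T r = topology (\<lambda>U. U \<subseteq> topspace T // r \<and> openin T {x \<in> topspace T. r `` {x} \<in> U})"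

lemma openin_quotient_topology:
  "openin (quotient_topology T r) U \<longleftrightarrow>
     U \<subseteq> topspace T // r \<and> openin T {x \<in> topspace T. r `` {x} \<in> U}"
proof -
  have "istopology (\<lambda>U. U \<subseteq> topspace T // r \<and> openin T {x \<in> topspace T. r `` {x} \<in> U})"
    unfolding istopology_def
  proof (intro conjI allI impI; (elim conjE)?)
    fix S S' :: "'a set set"
    assume "openin T {x \<in> topspace T. r `` {x} \<in> S}" "openin T {x \<in> topspace T. r `` {x} \<in> S'}"
    then have "openin T ({x \<in> topspace T. r `` {x} \<in> S} \<inter> {x \<in> topspace T. r `` {x} \<in> S'})"
      by (rule openin_Int)
    moreover have "{x \<in> topspace T. r `` {x} \<in> S} \<inter> {x \<in> topspace T. r `` {x} \<in> S'} =
        {x \<in> topspace T. r `` {x} \<in> S \<inter> S'}" by auto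
    ultimately show "openin T {x \<in> topspace T. r `` {x} \<in> S \<inter> S'}" by simp
  next
    fix \<K> :: "'a set set set"
    assume *: "\<forall>K\<in>\<K>. K \<subseteq> topspace T // r \<and> openin T {x \<in> topspace T. r `` {x} \<in> K}"
    then have "openin T (\<Union>K\<in>\<K>. {x \<in> topspace T. r `` {x} \<in> K})"
      by (intro openin_Union) auto
    moreover have "(\<Union>K\<in>\<K>. {x \<in> topspace T. r `` {x} \<in> K}) =
        {x \<in> topspace T. r `` {x} \<in> \<Union>\<K>}" by auto
    ultimately show "openin T {x \<in> topspace T. r `` {x} \<in> \<Union>\<K>}" by simp
    from * show "\<Union>\<K> \<subseteq> topspace T // r" by blast
  qed auto
  then show ?thesis
    unfolding quotient_topology_def by (simp add: topology_inverse')
qed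

lemma topspace_quotient_topology: "topspace (quotient_topology T r) = topspace T // r"
proof -
  have "{x \<in> topspace T. r `` {x} \<in> topspace T // r} = topspace T"
    by (auto simp: quotientI)
  then have "openin (quotient_topology T r) (topspace T // r)"
    by (simp add: openin_quotient_topology)
  then show ?thesis
    by (meson openin_quotient_topology openin_subset openin_topspace subset_antisym)
qed

lemma quotient_map_quotient_topology:
  "quotient_map T (quotient_topology T r) (\<lambda>x. r `` {x})"
  unfolding quotient_map_def
  by (auto simp: topspace_quotient_topology openin_quotient_topology quotient_def)

text \<open>The choice of carrier types is no restriction: a finite structure is isomorphic to one
  carried by a set of naturals, and the space of a topological structure, being compact, Hausdorff,
  zero-dimensional and second countable, embeds in \<open>nat \<Rightarrow> bool\<close>. The topology of the limit is
  not tied to that of \<open>nat \<Rightarrow> bool\<close>. As the limit is unique up to isomorphism,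
  asking for some limit is the same as speaking about the limit.\<close>

definition representable :: "'s language \<Rightarrow> 's \<Rightarrow> 'x topology \<Rightarrow> bool" where
  "representable L R X \<longleftrightarrow>
     language L \<and> R \<in> rel_syms L \<and> rel_arity L R = 2 \<and>
     compact_space X \<and> metrizable_space X \<and>
     (\<exists>(\<F> :: ('s, nat) topstruct set) (M :: ('s, nat \<Rightarrow> bool) topstruct).
        countable \<F> \<and> (\<forall>D\<in>\<F>. finite (carrier_of D)) \<and>
        projective_Fraisse_family L \<F> \<and> projective_Fraisse_limit L \<F> M \<and>
        equiv (carrier_of M) (binary_rel_of M R) \<and>
        quotient_topology (space_of M) (binary_rel_of M R) homeomorphic_space X)"

text \<open>The symbols of a finite language can be taken to be naturals.\<close>

definition finitely_representable :: "'x topology \<Rightarrow> bool" where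
  "finitely_representable X \<longleftrightarrow>
     (\<exists>(L :: nat language) R. finite_language L \<and> representable L R X)"

end

theory Submission
  imports Defs
begin

text \<open>It suffices to treat two factors \<open>X\<close> and \<open>Y\<close>, represented by families \<open>\<F>\<^sub>1\<close>, \<open>\<F>\<^sub>2\<close> with
  limits \<open>M\<^sub>1\<close>, \<open>M\<^sub>2\<close>. Replacing functions by their graphs and constants by singletons does not change
  the epimorphisms, so both languages may be taken purely relational. On the products \<open>D \<times> E\<close> let the
  symbols of each language speak about the corresponding coordinate, and add symbols for the kernels of
  the two projections. An epimorphism preserving both kernels splits as a product \<open>f \<times> g\<close>, and then
  \<open>f\<close> and \<open>g\<close> are epimorphisms; hence the products form a projective Fraisse family with limit
  \<open>M\<^sub>1 \<times> M\<^sub>2\<close>. The coordinatewise distinguished relation on \<open>M\<^sub>1 \<times> M\<^sub>2\<close> has quotient \<open>X \<times> Y\<close>. The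
  splitting needs non-empty structures; if \<open>X\<close> or \<open>Y\<close> is empty, then so is \<open>X \<times> Y\<close>.\<close>

section \<open>Zero-dimensional products and quotients\<close>

text \<open>A function symbol or a constant of one factor has no evident counterpart on
  \<open>D \<times> E\<close>, because the other coordinate of its value would have to be chosen. A
  relation extends by leaving the other coordinate free; hence the passage to relational languages.
  The obstacle is amalgamation: it concerns all epimorphisms between products, and an epimorphism
  that mixes the coordinates cannot be amalgamated factor by factor. The kernels exclude mixing, and
  since every product of two surjections maps them onto their counterparts, they exclude no product
  map. The distinguished relations of the factors each constrain one coordinate only, so a new
  symbol \<open>Both\<close> takes over their role. Condition (L2) does not reduce to the factors by
  splitting maps: a continuous map from the product to a finite space must be shown to factor
  through a product of finite quotients, by compactness and zero-dimensionality. Non-emptiness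
  enters twice: \<open>f\<close> and \<open>g\<close> are read off along slices through base points,
  and a relation on \<open>D\<close> is determined by its product with a power of \<open>E\<close>
  only if that power has a point.\<close>

lemma second_countable_prod_topology:
  assumes "second_countable X" "second_countable Y"
  shows "second_countable (prod_topology X Y)"
proof -
  obtain \<B> where B: "countable \<B>" "\<And>V. V \<in> \<B> \<Longrightarrow> openin X V"
      "\<And>U x. openin X U \<Longrightarrow> x \<in> U \<Longrightarrow> \<exists>V\<in>\<B>. x \<in> V \<and> V \<subseteq> U"
    using assms(1) unfolding second_countable_def by metis
  obtain \<C> where C: "countable \<C>" "\<And>V. V \<in> \<C> \<Longrightarrow> openin Y V"
      "\<And>U x. openin Y U \<Longrightarrow> x \<in> U \<Longrightarrow> \<exists>V\<in>\<C>. x \<in> V \<and> V \<subseteq> U"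
    using assms(2) unfolding second_countable_def by metis
  have "\<exists>V\<in>(\<lambda>(b, c). b \<times> c) ` (\<B> \<times> \<C>). p \<in> V \<and> V \<subseteq> U"
    if U: "openin (prod_topology X Y) U" and p: "p \<in> U" for U p
  proof -
    obtain x y where xy: "p = (x, y)" by (cases p)
    obtain G H where GH: "openin X G" "openin Y H" "x \<in> G" "y \<in> H" "G \<times> H \<subseteq> U"
      using U p xy unfolding openin_prod_topology_alt by meson
    obtain b c where "b \<in> \<B>" "x \<in> b" "b \<subseteq> G" "c \<in> \<C>" "y \<in> c" "c \<subseteq> H"
      using B(3)[OF GH(1,3)] C(3)[OF GH(2,4)] by blast
    then show ?thesis
      using GH(5) xy by (intro bexI[of _ "b \<times> c"]) auto
  qed
  moreover have "\<forall>V\<in>(\<lambda>(b, c). b \<times> c) ` (\<B> \<times> \<C>). openin (prod_topology X Y) V"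
    using B(2) C(2) by (auto simp: openin_prod_Times_iff)
  ultimately show ?thesis
    unfolding second_countable_def using B(1) C(1)
    by (intro exI[of _ "(\<lambda>(b, c). b \<times> c) ` (\<B> \<times> \<C>)"]) simp
qed

lemma zero_dimensional_clopen_nbhd:
  assumes "X dim_le 0" "openin X V" "x \<in> V"
  obtains U where "openin X U" "closedin X U" "x \<in> U" "U \<subseteq> V"
  using assms unfolding dimension_le_0_neighbourhood_base_of_clopen
  by (force simp: open_neighbourhood_base_of)

lemma zero_dimensional_prod_topology:
  assumes "X dim_le 0" "Y dim_le 0"
  shows "prod_topology X Y dim_le 0"
proof -
  have "\<exists>U. (closedin (prod_topology X Y) U \<and> openin (prod_topology X Y) U) \<and> p \<in> U \<and> U \<subseteq> W"
    if W: "openin (prod_topology X Y) W" and p: "p \<in> W" for W p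
  proof -
    obtain x y where xy: "p = (x, y)" by (cases p)
    obtain G H where GH: "openin X G" "openin Y H" "x \<in> G" "y \<in> H" "G \<times> H \<subseteq> W"
      using W p xy unfolding openin_prod_topology_alt by meson
    obtain U where U: "openin X U" "closedin X U" "x \<in> U" "U \<subseteq> G"
      by (rule zero_dimensional_clopen_nbhd[OF assms(1) GH(1,3)])
    obtain V where V: "openin Y V" "closedin Y V" "y \<in> V" "V \<subseteq> H"
      by (rule zero_dimensional_clopen_nbhd[OF assms(2) GH(2,4)])
    show ?thesis
      using U V GH(5) xy
      by (intro exI[of _ "U \<times> V"]) (auto simp: openin_prod_Times_iff closedin_prod_Times_iff)
  qed
  then show ?thesis
    unfolding dimension_le_0_neighbourhood_base_of_clopen
    by (subst open_neighbourhood_base_of) auto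
qed

text \<open>A continuous surjection from a compact space onto a Hausdorff space is a quotient map,
  so \<open>X\<close> is the quotient by the kernel of any such \<open>q\<close>. Working with
  \<open>q\<close> instead of classes makes products easy: \<open>q1 \<times> q2\<close> is again a
  continuous surjection of this kind.\<close>

lemma quotient_topology_homeomorphic_iff:
  assumes "compact_space T" "Hausdorff_space X" "r \<subseteq> topspace T \<times> topspace T"
  shows "equiv (topspace T) r \<and> quotient_topology T r homeomorphic_space X \<longleftrightarrow>
    (\<exists>q. continuous_map T X q \<and> q ` topspace T = topspace X \<and>
         r = {(x, y). x \<in> topspace T \<and> y \<in> topspace T \<and> q x = q y})"
    (is "?L \<longleftrightarrow> ?R")
proof
  assume L: ?L
  then obtain h where h: "homeomorphic_map (quotient_topology T r) X h"
    unfolding homeomorphic_space by blast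
  have q: "quotient_map T X (h \<circ> (\<lambda>x. r `` {x}))"
    by (rule quotient_map_compose[OF quotient_map_quotient_topology
          h[unfolded homeomorphic_map_def, THEN conjunct1]])
  have inj: "inj_on h (topspace T // r)"
    using h by (simp add: homeomorphic_eq_everything_map topspace_quotient_topology)
  have "(h \<circ> (\<lambda>x. r `` {x})) x = (h \<circ> (\<lambda>x. r `` {x})) y \<longleftrightarrow> (x, y) \<in> r"
    if "x \<in> topspace T" "y \<in> topspace T" for x y
    using L that inj_on_eq_iff[OF inj, of "r `` {x}" "r `` {y}"] eq_equiv_class_iff[of "topspace T" r x y]
    by (auto simp: quotientI)
  then have "r = {(x, y). x \<in> topspace T \<and> y \<in> topspace T \<and>
      (h \<circ> (\<lambda>x. r `` {x})) x = (h \<circ> (\<lambda>x. r `` {x})) y}"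
    using assms(3) by fast
  then show ?R
    using quotient_imp_continuous_map[OF q] quotient_imp_surjective_map[OF q] by blast
next
  assume ?R
  then obtain q where q: "continuous_map T X q" "q ` topspace T = topspace X"
    and r: "r = {(x, y). x \<in> topspace T \<and> y \<in> topspace T \<and> q x = q y}" by blast
  have eqv: "equiv (topspace T) r"
    unfolding r by (rule equivI) (auto simp: refl_on_def sym_def trans_def)
  have qm: "quotient_map T X q"
    by (rule T1_Spaces.continuous_imp_quotient_map) (use assms q in auto)
  have qm': "quotient_map T (quotient_topology T r) (\<lambda>x. r `` {x})"
    by (rule quotient_map_quotient_topology)
  have cls: "r `` {x} = r `` {y} \<longleftrightarrow> q x = q y" if "x \<in> topspace T" "y \<in> topspace T" for x y
    using eq_equiv_class_iff[OF eqv that] that r by auto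
  \<comment> \<open>The class map and \<open>q\<close> are quotient maps with the same fibres
    (\<open>cls\<close>), so each factors through the other, and the two factorisations are mutually
    inverse.\<close>
  obtain g where g: "continuous_map (quotient_topology T r) X g"
      "\<And>x. x \<in> topspace T \<Longrightarrow> g (r `` {x}) = q x"
    using quotient_map_lift_exists[OF qm' q(1)] cls by metis
  obtain f where f: "continuous_map X (quotient_topology T r) f"
      "\<And>x. x \<in> topspace T \<Longrightarrow> f (q x) = r `` {x}"
    using quotient_map_lift_exists[OF qm quotient_imp_continuous_map[OF qm']] cls by metis
  have "homeomorphic_maps (quotient_topology T r) X g f"
    unfolding homeomorphic_maps_def
  proof (intro conjI ballI)
    fix c assume "c \<in> topspace (quotient_topology T r)"
    then obtain x where "x \<in> topspace T" "c = r `` {x}"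
      by (auto simp: topspace_quotient_topology quotient_def)
    then show "f (g c) = c" using f g by simp
  next
    fix y assume "y \<in> topspace X"
    then obtain x where "x \<in> topspace T" "y = q x" using q by blast
    then show "g (f y) = y" using f g by simp
  qed (use f g in auto)
  then show ?L
    using eqv unfolding homeomorphic_space_def by blast
qed

lemma homeomorphic_space_second_countable:
  assumes "X homeomorphic_space Y" "second_countable X"
  shows "second_countable Y"
proof -
  obtain h where "homeomorphic_map X Y h"
    using assms(1) unfolding homeomorphic_space by blast
  then show ?thesis
    using second_countable_open_map_image[of X Y h] assms(2)
    by (simp add: homeomorphic_eq_everything_map)
qed

text \<open>The points lying in the same sets \<open>w s\<close> as \<open>z0\<close> form a finite
  intersection of clopen sets, hence an open neighbourhood of \<open>z0\<close> on which
  \<open>g\<close> is constant.\<close>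

lemma continuous_map_clopen_partition:
  assumes "finite \<S>" and w: "\<And>s. s \<in> \<S> \<Longrightarrow> openin Z (w s) \<and> closedin Z (w s)"
    and "g \<in> topspace Z \<rightarrow> B"
    and g: "\<And>z z'. \<forall>s\<in>\<S>. z \<in> w s \<longleftrightarrow> z' \<in> w s \<Longrightarrow> g z = g z'"
  shows "continuous_map Z (discrete_topology B) g"
  unfolding continuous_map_def
proof (intro conjI allI impI)
  show "g \<in> topspace Z \<rightarrow> topspace (discrete_topology B)"
    using assms(3) by simp
  fix V
  have "\<exists>T. openin Z T \<and> z0 \<in> T \<and> T \<subseteq> {z \<in> topspace Z. g z \<in> V}"
    if z0: "z0 \<in> topspace Z" "g z0 \<in> V" for z0
  proof -
    define T where "T = (\<Inter>s\<in>\<S>. {z \<in> topspace Z. z \<in> w s \<longleftrightarrow> z0 \<in> w s}) \<inter> topspace Z"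
    have "openin Z {z \<in> topspace Z. z \<in> w s \<longleftrightarrow> z0 \<in> w s}" if "s \<in> \<S>" for s
    proof (cases "z0 \<in> w s")
      case True
      then have "{z \<in> topspace Z. z \<in> w s \<longleftrightarrow> z0 \<in> w s} = w s"
        using w[OF that] openin_subset by fastforce
      then show ?thesis using w[OF that] by simp
    next
      case False
      then have "{z \<in> topspace Z. z \<in> w s \<longleftrightarrow> z0 \<in> w s} = topspace Z - w s" by blast
      then show ?thesis using w[OF that] by (simp add: openin_diff)
    qed
    then have "openin Z T"
      unfolding T_def using assms(1) by (intro openin_INT) auto
    moreover have "z0 \<in> T" using z0 by (simp add: T_def)
    moreover have "g z \<in> V" if "z \<in> T" for z
    proof -
      have "g z = g z0"
        by (rule g) (use that in \<open>auto simp: T_def\<close>)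
      then show ?thesis using z0(2) by simp
    qed
    ultimately show ?thesis
      by (intro exI[of _ T]) (auto simp: T_def)
  qed
  then show "openin Z {z \<in> topspace Z. g z \<in> V}"
    by (subst openin_subopen) simp
qed

text \<open>Clopen rectangles on which \<open>f\<close> is constant cover the product; recording to which members of
  a finite subcover a coordinate belongs gives \<open>g\<close> and \<open>h\<close>.\<close>

lemma continuous_map_prod_discrete_factor:
  assumes "compact_space X" "X dim_le 0" "compact_space Y" "Y dim_le 0"
    and f: "continuous_map (prod_topology X Y) (discrete_topology A) f"
  obtains B :: "nat set" and g h where "finite B"
    "continuous_map X (discrete_topology B) g" "continuous_map Y (discrete_topology B) h"
    "\<forall>x\<in>topspace X. \<forall>y\<in>topspace Y. \<forall>x'\<in>topspace X. \<forall>y'\<in>topspace Y.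
       g x = g x' \<longrightarrow> h y = h y' \<longrightarrow> f (x, y) = f (x', y')"
proof -
  define \<R> where "\<R> = {(U, V). openin X U \<and> closedin X U \<and> openin Y V \<and> closedin Y V \<and>
    (\<forall>p\<in>U \<times> V. \<forall>p'\<in>U \<times> V. f p = f p')}"
  have cover: "\<exists>(U, V)\<in>\<R>. p \<in> U \<times> V" if p: "p \<in> topspace (prod_topology X Y)" for p
  proof -
    obtain x y where xy: "p = (x, y)" by (cases p)
    have "f p \<in> A" using continuous_map_funspace[OF f] p by auto
    \<comment> \<open>The level set of \<open>f\<close> through \<open>p\<close> is open because the
      target is discrete. A basic rectangle inside it is then shrunk to one with clopen
      sides.\<close>
    define W where "W = {z \<in> topspace (prod_topology X Y). f z \<in> {f p}}"
    have "openin (prod_topology X Y) W"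
      unfolding W_def using \<open>f p \<in> A\<close> by (intro openin_continuous_map_preimage[OF f]) auto
    moreover have "(x, y) \<in> W" using p xy by (simp add: W_def)
    ultimately obtain G H where GH: "openin X G" "openin Y H" "x \<in> G" "y \<in> H" "G \<times> H \<subseteq> W"
      unfolding openin_prod_topology_alt by meson
    obtain U where U: "openin X U" "closedin X U" "x \<in> U" "U \<subseteq> G"
      by (rule zero_dimensional_clopen_nbhd[OF assms(2) GH(1,3)])
    obtain V where V: "openin Y V" "closedin Y V" "y \<in> V" "V \<subseteq> H"
      by (rule zero_dimensional_clopen_nbhd[OF assms(4) GH(2,4)])
    have "f z = f p" if "z \<in> U \<times> V" for z
      using that GH(5) U(4) V(4) by (auto simp: W_def)
    then have "(U, V) \<in> \<R>" using U V unfolding \<R>_def by auto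
    then show ?thesis using U(3) V(3) xy by blast
  qed
  have "compact_space (prod_topology X Y)"
    using assms(1,3) by (simp add: compact_space_prod_topology)
  moreover have "\<forall>W\<in>(\<lambda>(U, V). U \<times> V) ` \<R>. openin (prod_topology X Y) W"
    by (auto simp: \<R>_def openin_prod_Times_iff)
  moreover have "topspace (prod_topology X Y) \<subseteq> \<Union>((\<lambda>(U, V). U \<times> V) ` \<R>)"
    using cover by fast
  ultimately obtain \<W> where W: "finite \<W>" "\<W> \<subseteq> (\<lambda>(U, V). U \<times> V) ` \<R>"
      "topspace (prod_topology X Y) \<subseteq> \<Union>\<W>"
    unfolding compact_space_alt by meson
  obtain \<S> where S: "\<S> \<subseteq> \<R>" "finite \<S>"
      "topspace (prod_topology X Y) \<subseteq> \<Union>((\<lambda>(U, V). U \<times> V) ` \<S>)"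
    using finite_subset_image[OF W(1,2)] W(3) by blast
  \<comment> \<open>(L2) speaks of finite sets of naturals, so \<open>g\<close> and \<open>h\<close>
    must have natural values. The rectangles in \<open>\<S>\<close> are numbered, and
    \<open>code P\<close> is the natural whose binary digits mark the rectangles satisfying
    \<open>P\<close>.\<close>
  obtain \<iota> :: "'a set \<times> 'b set \<Rightarrow> nat" where \<iota>: "inj_on \<iota> \<S>"
    using finite_imp_inj_to_nat_seg[OF S(2)] by blast
  define code where "code P = set_encode (\<iota> ` {s \<in> \<S>. P s})" for P
  define B where "B = set_encode ` Pow (\<iota> ` \<S>)"
  have code_eq: "P s \<longleftrightarrow> Q s" if "code P = code Q" "s \<in> \<S>" for P Q s
  proof -
    have "\<iota> ` {s \<in> \<S>. P s} = \<iota> ` {s \<in> \<S>. Q s}"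
      by (rule inj_onD[OF inj_on_set_encode]) (use that(1) S(2) in \<open>auto simp: code_def\<close>)
    then have "{s \<in> \<S>. P s} = {s \<in> \<S>. Q s}"
      using \<iota> by (subst (asm) inj_on_image_eq_iff) auto
    then show ?thesis using that(2) by blast
  qed
  have fin: "finite B" using S(2) by (simp add: B_def)
  have code_cong: "code P = code Q" if "\<forall>s\<in>\<S>. P s \<longleftrightarrow> Q s" for P Q
  proof -
    have "{s \<in> \<S>. P s} = {s \<in> \<S>. Q s}" using that by blast
    then show ?thesis by (simp add: code_def)
  qed
  have code_B: "code P \<in> B" for P by (auto simp: code_def B_def)
  show thesis
  proof (rule that[OF fin])
    show "continuous_map X (discrete_topology B) (\<lambda>x. code (\<lambda>s. x \<in> fst s))"
      using S(1,2) by (intro continuous_map_clopen_partition[of \<S> X fst])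
        (auto simp: \<R>_def code_B intro: code_cong)
    show "continuous_map Y (discrete_topology B) (\<lambda>y. code (\<lambda>s. y \<in> snd s))"
      using S(1,2) by (intro continuous_map_clopen_partition[of \<S> Y snd])
        (auto simp: \<R>_def code_B intro: code_cong)
  next
    have "f (x, y) = f (x', y')"
      if xy: "x \<in> topspace X" "y \<in> topspace Y"
        and eq: "code (\<lambda>s. x \<in> fst s) = code (\<lambda>s. x' \<in> fst s)"
          "code (\<lambda>s. y \<in> snd s) = code (\<lambda>s. y' \<in> snd s)" for x y x' y'
    proof -
      have "(x, y) \<in> \<Union>((\<lambda>(U, V). U \<times> V) ` \<S>)" using S(3) xy by auto
      \<comment> \<open>One rectangle through \<open>(x, y)\<close> suffices: equal codes put
        \<open>x'\<close> into its first side and \<open>y'\<close> into its second.\<close>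
      then obtain s where s: "s \<in> \<S>" "x \<in> fst s" "y \<in> snd s" by auto
      then have "x' \<in> fst s" "y' \<in> snd s"
        using code_eq[OF eq(1) s(1)] code_eq[OF eq(2) s(1)] by auto
      then have "(x, y) \<in> fst s \<times> snd s" "(x', y') \<in> fst s \<times> snd s" using s(2,3) by auto
      moreover have "\<forall>p\<in>fst s \<times> snd s. \<forall>p'\<in>fst s \<times> snd s. f p = f p'"
        using subsetD[OF S(1) s(1)] unfolding \<R>_def mem_Collect_eq split_beta by (elim conjE)
      ultimately show ?thesis by blast
    qed
    then show "\<forall>x\<in>topspace X. \<forall>y\<in>topspace Y. \<forall>x'\<in>topspace X. \<forall>y'\<in>topspace Y.
        code (\<lambda>s. x \<in> fst s) = code (\<lambda>s. x' \<in> fst s) \<longrightarrow>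
        code (\<lambda>s. y \<in> snd s) = code (\<lambda>s. y' \<in> snd s) \<longrightarrow> f (x, y) = f (x', y')"
      by blast
  qed
qed

section \<open>Reduction to relational languages\<close>

text \<open>The tags keep apart the roles of a symbol that occurs as relation, function and constant
  symbol at once. Countability lets \<open>to_nat\<close> rename the tagged symbols to
  naturals.\<close>

datatype 's relsym = Rel 's | Graph 's | Point 's

instance relsym :: (countable) countable
  by countable_datatype

definition relational_language :: "'s::countable language \<Rightarrow> nat language" where
  "relational_language L =
     \<lparr>rel_syms = to_nat ` (Rel ` rel_syms L \<union> Graph ` fun_syms L \<union> Point ` const_syms L),
      fun_syms = {}, const_syms = {},
      rel_arity = (\<lambda>t. case from_nat t of
          Rel r \<Rightarrow> rel_arity L r | Graph f \<Rightarrow> Suc (fun_arity L f) | Point c \<Rightarrow> 1),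
      fun_arity = (\<lambda>_. 1)\<rparr>"

definition graph_of :: "nat \<Rightarrow> ('s, 'a) topstruct \<Rightarrow> 's \<Rightarrow> (nat \<Rightarrow> 'a) set" where
  "graph_of n A f = {u \<in> {..<Suc n} \<rightarrow>\<^sub>E carrier_of A. u n = fun_of A f (restrict u {..<n})}"

definition point_of :: "('s, 'a) topstruct \<Rightarrow> 's \<Rightarrow> (nat \<Rightarrow> 'a) set" where
  "point_of A c = {u \<in> {..<Suc 0} \<rightarrow>\<^sub>E carrier_of A. u 0 = const_of A c}"

definition relational_structure ::
    "'s::countable language \<Rightarrow> ('s, 'a) topstruct \<Rightarrow> (nat, 'a) topstruct" where
  "relational_structure L A =
     \<lparr>space_of = space_of A,
      rel_of = (\<lambda>t. case from_nat t of
          Rel r \<Rightarrow> rel_of A r | Graph f \<Rightarrow> graph_of (fun_arity L f) A f | Point c \<Rightarrow> point_of A c),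
      fun_of = (\<lambda>_ _. undefined), const_of = (\<lambda>_. undefined)\<rparr>"

lemma space_of_relational_structure [simp]:
  "space_of (relational_structure L A) = space_of A"
  by (simp add: relational_structure_def)

lemma finite_relational_language:
  "finite_language L \<Longrightarrow> finite_language (relational_language L)"
  by (auto simp: finite_language_def language_def relational_language_def)

text \<open>The free predicate \<open>P\<close> serves two purposes: closedness of the
  interpretations in one structure, and the image condition relating two structures.\<close>

lemma ball_rel_syms_relational_language:
  "(\<forall>t\<in>rel_syms (relational_language L).
      P (rel_arity (relational_language L) t) (rel_of (relational_structure L A) t)
        (rel_of (relational_structure L B) t)) \<longleftrightarrow>
   (\<forall>r\<in>rel_syms L. P (rel_arity L r) (rel_of A r) (rel_of B r)) \<and>
   (\<forall>f\<in>fun_syms L. P (Suc (fun_arity L f)) (graph_of (fun_arity L f) A f)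
                     (graph_of (fun_arity L f) B f)) \<and>
   (\<forall>c\<in>const_syms L. P (Suc 0) (point_of A c) (point_of B c))"
  by (simp add: relational_language_def relational_structure_def ball_Un)

lemma closedin_graph_of:
  assumes "Hausdorff_space (space_of A)"
    and f: "continuous_map (power_topology n (space_of A)) (space_of A) (fun_of A f)"
  shows "closedin (power_topology (Suc n) (space_of A)) (graph_of n A f)"
proof -
  have r: "continuous_map (power_topology (Suc n) (space_of A)) (power_topology n (space_of A))
      (\<lambda>u. restrict u {..<n})"
    by (auto simp: continuous_map_componentwise intro!: continuous_map_product_projection)
  have "closedin (power_topology (Suc n) (space_of A))
      {u \<in> topspace (power_topology (Suc n) (space_of A)). u n = (fun_of A f \<circ> (\<lambda>u. restrict u {..<n})) u}"
    by (rule closedin_continuous_maps_eq[OF assms(1) _ continuous_map_compose[OF r f]])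
       (rule continuous_map_product_projection, simp)
  then show ?thesis by (simp add: graph_of_def)
qed

lemma closedin_point_of:
  assumes "Hausdorff_space (space_of A)" "const_of A c \<in> carrier_of A"
  shows "closedin (power_topology (Suc 0) (space_of A)) (point_of A c)"
proof -
  have "closedin (power_topology (Suc 0) (space_of A))
      {u \<in> topspace (power_topology (Suc 0) (space_of A)). u 0 = const_of A c}"
    by (rule closedin_continuous_maps_eq[OF assms(1)], rule continuous_map_product_projection)
       (use assms(2) in auto)
  then show ?thesis by (simp add: point_of_def)
qed

lemma topological_structure_relational:
  assumes "topological_structure L A"
  shows "topological_structure (relational_language L) (relational_structure L A)"
proof -
  have "\<forall>t\<in>rel_syms (relational_language L).
      closedin (power_topology (rel_arity (relational_language L) t) (space_of A))
        (rel_of (relational_structure L A) t)"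
    using assms closedin_graph_of[of A] closedin_point_of[of A]
    unfolding ball_rel_syms_relational_language[where P = "\<lambda>n S _. closedin (power_topology n (space_of A)) S"]
    by (simp add: topological_structure_def)
  then show ?thesis
    using assms unfolding topological_structure_def by (simp add: relational_language_def)
qed

text \<open>Commuting with \<open>f\<close> amounts to mapping the graph into the graph. That the
  whole graph over \<open>B\<close> is reached follows from surjectivity, since arguments lift and
  the lifted arguments have the right value.\<close>

lemma compose_image_graph_of_iff:
  assumes im: "\<phi> ` carrier_of A = carrier_of B"
    and f: "fun_of A f \<in> ({..<n} \<rightarrow>\<^sub>E carrier_of A) \<rightarrow> carrier_of A"
  shows "graph_of n B f = compose {..<Suc n} \<phi> ` graph_of n A f \<longleftrightarrow>
    (\<forall>a \<in> {..<n} \<rightarrow>\<^sub>E carrier_of A. fun_of B f (compose {..<n} \<phi> a) = \<phi> (fun_of A f a))"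
    (is "?L \<longleftrightarrow> ?R")
proof
  assume L: ?L
  show ?R
  proof
    fix a assume a: "a \<in> {..<n} \<rightarrow>\<^sub>E carrier_of A"
    \<comment> \<open>Position \<open>n\<close> holds the value. The image of this tuple lies in the
      graph over \<open>B\<close>, and comparing entries at \<open>n\<close> gives the
      equation.\<close>
    define u where "u = a(n := fun_of A f a)"
    have [simp]: "restrict u {..<n} = a"
      using a by (auto simp: u_def fun_eq_iff restrict_def PiE_iff extensional_def)
    have "u \<in> {..<Suc n} \<rightarrow>\<^sub>E carrier_of A"
      using a f by (auto simp: u_def PiE_iff extensional_def)
    then have "u \<in> graph_of n A f" by (simp add: graph_of_def u_def[THEN fun_cong])
    then have "compose {..<Suc n} \<phi> u \<in> graph_of n B f" using L by blast
    moreover have "restrict (compose {..<Suc n} \<phi> u) {..<n} = compose {..<n} \<phi> a"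
      by (auto simp: u_def compose_def fun_eq_iff)
    ultimately show "fun_of B f (compose {..<n} \<phi> a) = \<phi> (fun_of A f a)"
      by (simp add: graph_of_def compose_def u_def)
  qed
next
  assume R: ?R
  show ?L
  proof
    show "compose {..<Suc n} \<phi> ` graph_of n A f \<subseteq> graph_of n B f"
    proof (rule image_subsetI)
      fix u assume "u \<in> graph_of n A f"
      then have u: "u \<in> {..<Suc n} \<rightarrow>\<^sub>E carrier_of A" "u n = fun_of A f (restrict u {..<n})"
        by (simp_all add: graph_of_def)
      have "restrict (compose {..<Suc n} \<phi> u) {..<n} = compose {..<n} \<phi> (restrict u {..<n})"
        by (rule ext) (simp add: compose_def)
      moreover have "restrict u {..<n} \<in> {..<n} \<rightarrow>\<^sub>E carrier_of A"
        using u(1) by (auto simp: PiE_iff)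
      moreover have "compose {..<Suc n} \<phi> u \<in> {..<Suc n} \<rightarrow>\<^sub>E carrier_of B"
        using u(1) im by (auto simp: compose_def PiE_iff)
      moreover have "compose {..<Suc n} \<phi> u n = \<phi> (fun_of A f (restrict u {..<n}))"
        using u(2) by (simp add: compose_def)
      ultimately show "compose {..<Suc n} \<phi> u \<in> graph_of n B f"
        using R by (simp add: graph_of_def)
    qed
  next
    show "graph_of n B f \<subseteq> compose {..<Suc n} \<phi> ` graph_of n A f"
    proof
      fix v assume v: "v \<in> graph_of n B f"
      then have "v i \<in> \<phi> ` carrier_of A" if "i < n" for i
        using that unfolding im by (simp add: graph_of_def PiE_iff)
      then obtain b where b: "\<And>i. i < n \<Longrightarrow> b i \<in> carrier_of A \<and> \<phi> (b i) = v i"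
        unfolding image_iff by metis
      define a where "a = restrict b {..<n}"
      have a: "a \<in> {..<n} \<rightarrow>\<^sub>E carrier_of A" using b by (auto simp: a_def)
      have av: "compose {..<n} \<phi> a = restrict v {..<n}"
        using b by (auto simp: a_def compose_def fun_eq_iff)
      define u where "u = a(n := fun_of A f a)"
      have [simp]: "restrict u {..<n} = a"
        using a by (auto simp: u_def fun_eq_iff restrict_def PiE_iff extensional_def)
      have "u \<in> {..<Suc n} \<rightarrow>\<^sub>E carrier_of A"
        using a f by (auto simp: u_def PiE_iff extensional_def)
      then have "u \<in> graph_of n A f" by (simp add: graph_of_def u_def[THEN fun_cong])
      moreover have "compose {..<Suc n} \<phi> u = v"
      proof
        fix i
        consider "i < n" | "i = n" | "i > n" by linarith
        then show "compose {..<Suc n} \<phi> u i = v i"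
        proof cases
          case 1
          then show ?thesis using b by (simp add: compose_def u_def a_def)
        next
          case 2
          have "v n = fun_of B f (compose {..<n} \<phi> a)"
            using v by (simp add: graph_of_def av)
          then show ?thesis using R a 2 by (simp add: compose_def u_def)
        next
          case 3
          then show ?thesis using v by (auto simp: graph_of_def compose_def PiE_iff extensional_def)
        qed
      qed
      ultimately show "v \<in> compose {..<Suc n} \<phi> ` graph_of n A f" by blast
    qed
  qed
qed

lemma point_of_eq:
  "const_of A c \<in> carrier_of A \<Longrightarrow> point_of A c = {\<lambda>i\<in>{..<Suc 0}. const_of A c}"
  by (auto simp: point_of_def fun_eq_iff PiE_iff extensional_def)

lemma compose_image_point_of_iff:
  assumes "const_of A c \<in> carrier_of A" "const_of B c \<in> carrier_of B"
  shows "point_of B c = compose {..<Suc 0} \<phi> ` point_of A c \<longleftrightarrow> \<phi> (const_of A c) = const_of B c"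
  unfolding point_of_eq[OF assms(1)] point_of_eq[OF assms(2)]
  by (auto simp: fun_eq_iff compose_def restrict_def)

text \<open>Stated as an equality of predicates on maps, so that it rewrites inside the definitions
  of family, limit and isomorphism, where maps are quantified.\<close>

lemma epimorphism_relational_eq:
  assumes A: "topological_structure L A" and B: "topological_structure L B"
  shows "epimorphism (relational_language L) (relational_structure L A) (relational_structure L B)
    = epimorphism L A B"
proof
  fix \<phi>
  have "fun_of A f \<in> ({..<fun_arity L f} \<rightarrow>\<^sub>E carrier_of A) \<rightarrow> carrier_of A" if "f \<in> fun_syms L" for f
    using A that continuous_map_funspace[of "power_topology (fun_arity L f) (space_of A)" "space_of A" "fun_of A f"]
    by (simp add: topological_structure_def)
  moreover have "const_of A c \<in> carrier_of A \<and> const_of B c \<in> carrier_of B" if "c \<in> const_syms L" for c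
    using A B that by (simp add: topological_structure_def)
  \<comment> \<open>\<open>compose_image_graph_of_iff\<close> presupposes surjectivity; where
    surjectivity fails, both sides are false.\<close>
  ultimately show "epimorphism (relational_language L) (relational_structure L A)
      (relational_structure L B) \<phi> = epimorphism L A B \<phi>"
    unfolding epimorphism_def
      ball_rel_syms_relational_language[where P = "\<lambda>n S T. T = compose {..<n} \<phi> ` S"]
    by (cases "\<phi> ` carrier_of A = carrier_of B")
       (simp_all add: relational_language_def compose_image_graph_of_iff compose_image_point_of_iff
         cong: ball_cong)
qed

text \<open>The conditions on family and limit see a structure only through its space, its being a
  topological structure, and its epimorphisms. The reduction respects all three, and
  \<open>R\<close> keeps its interpretation under the new name. Applied to any countable symbol
  type, the lemma also renames symbols to naturals.\<close>

lemma representable_relational_language: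
  assumes "representable (L :: 's::countable language) R X"
  shows "representable (relational_language L) (to_nat (Rel R)) X"
proof -
  obtain \<F> :: "('s, nat) topstruct set" and M :: "('s, nat \<Rightarrow> bool) topstruct"
    where FM: "countable \<F>" "\<And>D. D \<in> \<F> \<Longrightarrow> finite (carrier_of D)"
      "projective_Fraisse_family L \<F>" "projective_Fraisse_limit L \<F> M"
      "equiv (carrier_of M) (binary_rel_of M R)"
      "quotient_topology (space_of M) (binary_rel_of M R) homeomorphic_space X"
    using assms unfolding representable_def by blast
  have top: "topological_structure L D" if "D \<in> \<F>" for D
    using FM(3) that by (simp add: projective_Fraisse_family_def)
  have topM: "topological_structure L M"
    using FM(4) by (simp add: projective_Fraisse_limit_def)
  let ?\<F> = "relational_structure L ` \<F>" and ?M = "relational_structure L M"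
  have "projective_Fraisse_family (relational_language L) ?\<F>"
    using FM(3) unfolding projective_Fraisse_family_def
    by (simp add: topological_structure_relational epimorphism_relational_eq top
        cong: ball_cong bex_cong)
  moreover have "projective_Fraisse_limit (relational_language L) ?\<F> ?M"
    using FM(4) unfolding projective_Fraisse_limit_def isomorphism_def
    by (simp add: topological_structure_relational epimorphism_relational_eq top topM
        cong: ball_cong bex_cong)
  moreover have "binary_rel_of ?M (to_nat (Rel R)) = binary_rel_of M R"
    by (simp add: binary_rel_of_def relational_structure_def)
  moreover have "language (relational_language L)" "to_nat (Rel R) \<in> rel_syms (relational_language L)"
      "rel_arity (relational_language L) (to_nat (Rel R)) = 2"
    using assms by (auto simp: representable_def language_def relational_language_def)
  moreover have "countable ?\<F>" "\<forall>D\<in>?\<F>. finite (carrier_of D)"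
    using FM(1,2) by auto
  ultimately show ?thesis
    using assms FM(5,6) unfolding representable_def
    by (intro conjI exI[of _ ?\<F>] exI[of _ ?M]) simp_all
qed

section \<open>Products of structures\<close>

text \<open>The pullback along \<open>inv e\<close> makes a bijection \<open>e\<close> a
  homeomorphism from the product. The encoding is there because \<open>representable\<close> fixes
  the carrier types \<open>nat\<close> and \<open>nat \<Rightarrow> bool\<close>, to which pairs do
  not belong.\<close>

definition prod_space :: "('a \<times> 'b \<Rightarrow> 'c) \<Rightarrow> 'a topology \<Rightarrow> 'b topology \<Rightarrow> 'c topology" where
  "prod_space e S T = pullback_topology UNIV (inv e) (prod_topology S T)"

lemma homeomorphic_maps_prod_space:
  assumes "bij e"
  shows "homeomorphic_maps (prod_topology S T) (prod_space e S T) e (inv e)"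
proof -
  have "continuous_map (prod_space e S T) (prod_topology S T) (inv e)"
    unfolding prod_space_def
    using continuous_map_pullback[OF continuous_map_id[of "prod_topology S T"], of UNIV "inv e"] by simp
  moreover have "inv e \<circ> e = id"
    using assms by (simp add: bij_is_inj)
  then have "continuous_map (prod_topology S T) (prod_space e S T) e"
    unfolding prod_space_def by (intro continuous_map_pullback') auto
  ultimately show ?thesis
    using assms by (simp add: homeomorphic_maps_def bij_is_inj bij_is_surj surj_f_inv_f)
qed

lemma prod_space_homeomorphic:
  "bij e \<Longrightarrow> prod_topology S T homeomorphic_space prod_space e S T"
  using homeomorphic_maps_prod_space homeomorphic_space_def by blast

lemma topspace_prod_space:
  assumes "bij e"
  shows "topspace (prod_space e S T) = e ` (topspace S \<times> topspace T)"
  using homeomorphic_imp_surjective_map[OF homeomorphic_maps_imp_map[OF homeomorphic_maps_prod_space[OF assms]]]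
  by (metis topspace_prod_topology)

definition prod_map ::
    "('a \<times> 'b \<Rightarrow> 'p) \<Rightarrow> ('c \<times> 'd \<Rightarrow> 'q) \<Rightarrow> ('a \<Rightarrow> 'c) \<Rightarrow> ('b \<Rightarrow> 'd) \<Rightarrow> 'p \<Rightarrow> 'q" where
  "prod_map e e' f g = e' \<circ> map_prod f g \<circ> inv e"

lemma prod_map_apply [simp]: "bij e \<Longrightarrow> prod_map e e' f g (e (a, b)) = e' (f a, g b)"
  by (simp add: prod_map_def bij_is_inj)

lemma continuous_map_prod_map:
  assumes "bij e" "bij e'" "continuous_map S S' f" "continuous_map T T' g"
  shows "continuous_map (prod_space e S T) (prod_space e' S' T') (prod_map e e' f g)"
proof -
  have "continuous_map (prod_topology S T) (prod_topology S' T') (map_prod f g)"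
    using assms(3,4) by (simp add: continuous_map_prod_top map_prod_def split_beta)
  then show ?thesis
    unfolding prod_map_def
    using homeomorphic_maps_prod_space[OF assms(1), of S T] homeomorphic_maps_prod_space[OF assms(2), of S' T']
    by (intro continuous_map_compose) (auto simp: homeomorphic_maps_def intro: continuous_map_compose)
qed

section \<open>Rectangles of tuples\<close>

definition pair_tuple :: "('a \<times> 'b \<Rightarrow> 'c) \<Rightarrow> nat \<Rightarrow> (nat \<Rightarrow> 'a) \<Rightarrow> (nat \<Rightarrow> 'b) \<Rightarrow> nat \<Rightarrow> 'c" where
  "pair_tuple e n s t = (\<lambda>i\<in>{..<n}. e (s i, t i))"

text \<open>This is \<open>S \<times> T\<close> under the identification of a pair of
  \<open>n\<close>-tuples with an \<open>n\<close>-tuple of pairs. For relations of this shape,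
  images and closedness can be treated in each factor separately.\<close>

definition rect ::
    "('a \<times> 'b \<Rightarrow> 'c) \<Rightarrow> nat \<Rightarrow> (nat \<Rightarrow> 'a) set \<Rightarrow> (nat \<Rightarrow> 'b) set \<Rightarrow> (nat \<Rightarrow> 'c) set" where
  "rect e n S T = (\<lambda>(s, t). pair_tuple e n s t) ` (S \<times> T)"

lemma rectI: "s \<in> S \<Longrightarrow> t \<in> T \<Longrightarrow> pair_tuple e n s t \<in> rect e n S T"
  by (auto simp: rect_def)

text \<open>The product form of \<open>\<phi>\<close> is assumed only on
  \<open>A \<times> B\<close>, so the lemma applies both to \<open>prod_map\<close> and to an
  epimorphism that has been shown to split on the carrier.\<close>

lemma compose_image_rect:
  assumes "S \<subseteq> {..<n} \<rightarrow>\<^sub>E A" "T \<subseteq> {..<n} \<rightarrow>\<^sub>E B"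
    and \<phi>: "\<And>a b. a \<in> A \<Longrightarrow> b \<in> B \<Longrightarrow> \<phi> (e (a, b)) = e' (f a, g b)"
  shows "compose {..<n} \<phi> ` rect e n S T = rect e' n (compose {..<n} f ` S) (compose {..<n} g ` T)"
proof -
  have eq: "compose {..<n} \<phi> (pair_tuple e n s t) = pair_tuple e' n (compose {..<n} f s) (compose {..<n} g t)"
    if "s \<in> S" "t \<in> T" for s t
  proof
    fix i
    have "s \<in> {..<n} \<rightarrow>\<^sub>E A" "t \<in> {..<n} \<rightarrow>\<^sub>E B" using that assms(1,2) by auto
    then show "compose {..<n} \<phi> (pair_tuple e n s t) i =
        pair_tuple e' n (compose {..<n} f s) (compose {..<n} g t) i"
      using \<phi>[of "s i" "t i"] by (auto simp: compose_def pair_tuple_def PiE_iff)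
  qed
  have "compose {..<n} \<phi> ` rect e n S T = (\<lambda>(s, t). compose {..<n} \<phi> (pair_tuple e n s t)) ` (S \<times> T)"
    unfolding rect_def image_image by (simp add: split_beta)
  also have "\<dots> = (\<lambda>(s, t). pair_tuple e' n (compose {..<n} f s) (compose {..<n} g t)) ` (S \<times> T)"
    using eq by (intro image_cong) auto
  also have "\<dots> = rect e' n (compose {..<n} f ` S) (compose {..<n} g ` T)"
    unfolding rect_def by force
  finally show ?thesis .
qed

lemma pair_tuple_inject:
  assumes "inj e" "s \<in> {..<n} \<rightarrow>\<^sub>E A" "s' \<in> {..<n} \<rightarrow>\<^sub>E A" "t \<in> {..<n} \<rightarrow>\<^sub>E B" "t' \<in> {..<n} \<rightarrow>\<^sub>E B"
    and "pair_tuple e n s t = pair_tuple e n s' t'"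
  shows "s = s'" "t = t'"
proof -
  have "s i = s' i \<and> t i = t' i" if "i < n" for i
    using fun_cong[OF assms(6), of i] that injD[OF assms(1)] by (fastforce simp: pair_tuple_def)
  then show "s = s'" "t = t'"
    using PiE_ext[OF assms(2,3)] PiE_ext[OF assms(4,5)] by auto
qed

text \<open>A product determines one factor as soon as the other is non-empty. Each conclusion asks
  for points on the opposite side only, so an empty relation is still recovered from its product
  with a non-empty full power.\<close>

lemma rect_inject:
  assumes "inj e" "S \<subseteq> {..<n} \<rightarrow>\<^sub>E A" "S' \<subseteq> {..<n} \<rightarrow>\<^sub>E A" "T \<subseteq> {..<n} \<rightarrow>\<^sub>E B" "T' \<subseteq> {..<n} \<rightarrow>\<^sub>E B"
    and eq: "rect e n S T = rect e n S' T'"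
  shows "T \<noteq> {} \<Longrightarrow> T' \<noteq> {} \<Longrightarrow> S = S'" "S \<noteq> {} \<Longrightarrow> S' \<noteq> {} \<Longrightarrow> T = T'"
proof -
  have *: "s \<in> S \<and> t \<in> T \<longleftrightarrow> s \<in> S' \<and> t \<in> T'"
    if "s \<in> {..<n} \<rightarrow>\<^sub>E A" "t \<in> {..<n} \<rightarrow>\<^sub>E B" for s t
  proof -
    have "s \<in> P \<and> t \<in> Q \<longleftrightarrow> pair_tuple e n s t \<in> rect e n P Q"
      if "P \<subseteq> {..<n} \<rightarrow>\<^sub>E A" "Q \<subseteq> {..<n} \<rightarrow>\<^sub>E B" for P Q
    proof
      assume "pair_tuple e n s t \<in> rect e n P Q"
      then obtain s' t' where st: "s' \<in> P" "t' \<in> Q" "pair_tuple e n s t = pair_tuple e n s' t'"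
        by (auto simp: rect_def)
      then have "s = s'" "t = t'"
        using pair_tuple_inject[OF assms(1) \<open>s \<in> _\<close> _ \<open>t \<in> _\<close> _ st(3)] that by auto
      then show "s \<in> P \<and> t \<in> Q" using st by simp
    qed (auto intro: rectI)
    then show ?thesis using eq assms(2-5) by metis
  qed
  show "S = S'" if ne: "T \<noteq> {}" "T' \<noteq> {}"
  proof -
    obtain t t' where "t \<in> T" "t' \<in> T'" using ne by blast
    then have "s \<in> S \<longleftrightarrow> s \<in> S'" if "s \<in> {..<n} \<rightarrow>\<^sub>E A" for s
      using *[OF that, of t] *[OF that, of t'] assms(4,5) by auto
    then show ?thesis using assms(2,3) by (meson subset_antisym subset_iff)
  qed
  show "T = T'" if ne: "S \<noteq> {}" "S' \<noteq> {}"
  proof -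
    obtain s s' where "s \<in> S" "s' \<in> S'" using ne by blast
    then have "t \<in> T \<longleftrightarrow> t \<in> T'" if "t \<in> {..<n} \<rightarrow>\<^sub>E B" for t
      using *[OF _ that, of s] *[OF _ that, of s'] assms(2,3) by auto
    then show ?thesis using assms(4,5) by (meson subset_antisym subset_iff)
  qed
qed

text \<open>The rectangle is the intersection of the preimages of \<open>S\<close> and
  \<open>T\<close> under the continuous maps that extract the first and the second coordinates of a
  tuple of codes.\<close>

lemma closedin_rect:
  assumes e: "bij e" and S: "closedin (power_topology n X) S" and T: "closedin (power_topology n Y) T"
  shows "closedin (power_topology n (prod_space e X Y)) (rect e n S T)"
proof -
  let ?P = "power_topology n (prod_space e X Y)"
  have inv: "continuous_map (prod_space e X Y) (prod_topology X Y) (inv e)"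
    using homeomorphic_maps_prod_space[OF e] by (auto simp: homeomorphic_maps_def)
  have p1: "continuous_map ?P (power_topology n X) (\<lambda>u. \<lambda>i\<in>{..<n}. fst (inv e (u i)))"
  proof (subst continuous_map_componentwise, intro conjI ballI)
    fix i assume "i \<in> {..<n}"
    then have "continuous_map ?P (prod_space e X Y) (\<lambda>u. u i)"
      by (rule continuous_map_product_projection)
    from continuous_map_compose[OF continuous_map_compose[OF this inv] continuous_map_fst]
    show "continuous_map ?P X (\<lambda>u. (\<lambda>i\<in>{..<n}. fst (inv e (u i))) i)"
      using \<open>i \<in> {..<n}\<close> by (simp add: o_def)
  qed auto
  have p2: "continuous_map ?P (power_topology n Y) (\<lambda>u. \<lambda>i\<in>{..<n}. snd (inv e (u i)))"
  proof (subst continuous_map_componentwise, intro conjI ballI)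
    fix i assume "i \<in> {..<n}"
    then have "continuous_map ?P (prod_space e X Y) (\<lambda>u. u i)"
      by (rule continuous_map_product_projection)
    from continuous_map_compose[OF continuous_map_compose[OF this inv] continuous_map_snd]
    show "continuous_map ?P Y (\<lambda>u. (\<lambda>i\<in>{..<n}. snd (inv e (u i))) i)"
      using \<open>i \<in> {..<n}\<close> by (simp add: o_def)
  qed auto
  have sub: "S \<subseteq> {..<n} \<rightarrow>\<^sub>E topspace X" "T \<subseteq> {..<n} \<rightarrow>\<^sub>E topspace Y"
    using closedin_subset[OF S] closedin_subset[OF T] by auto
  have "rect e n S T = {u \<in> topspace ?P. (\<lambda>i\<in>{..<n}. fst (inv e (u i))) \<in> S} \<inter>
      {u \<in> topspace ?P. (\<lambda>i\<in>{..<n}. snd (inv e (u i))) \<in> T}" (is "_ = ?R")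
  proof
    show "rect e n S T \<subseteq> ?R"
    proof
      fix u assume "u \<in> rect e n S T"
      then obtain s t where st: "s \<in> S" "t \<in> T" "u = pair_tuple e n s t" by (auto simp: rect_def)
      have sA: "s \<in> {..<n} \<rightarrow>\<^sub>E topspace X" and tA: "t \<in> {..<n} \<rightarrow>\<^sub>E topspace Y" using st sub by auto
      have "(\<lambda>i\<in>{..<n}. fst (inv e (u i))) = s" "(\<lambda>i\<in>{..<n}. snd (inv e (u i))) = t"
        using e sA tA by (auto simp: fun_eq_iff st(3) pair_tuple_def bij_is_inj PiE_iff extensional_def)
      moreover have "u \<in> topspace ?P"
        using sA tA by (auto simp: st(3) pair_tuple_def topspace_prod_space[OF e] PiE_iff)
      ultimately show "u \<in> ?R" using st by simp
    qed
  next
    show "?R \<subseteq> rect e n S T"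
    proof
      fix u assume u: "u \<in> ?R"
      have "u = pair_tuple e n (\<lambda>i\<in>{..<n}. fst (inv e (u i))) (\<lambda>i\<in>{..<n}. snd (inv e (u i)))"
        using u e by (auto simp: fun_eq_iff pair_tuple_def PiE_iff extensional_def bij_is_surj surj_f_inv_f)
      then show "u \<in> rect e n S T"
        using rectI[of "\<lambda>i\<in>{..<n}. fst (inv e (u i))" S "\<lambda>i\<in>{..<n}. snd (inv e (u i))" T e n] u by simp
    qed
  qed
  then show ?thesis
    using closedin_continuous_map_preimage[OF p1 S] closedin_continuous_map_preimage[OF p2 T] by auto
qed

section \<open>Language and structure of a product\<close>

datatype ('s, 't) prodsym = Both | Kernel1 | Kernel2 | Left 's | Right 't

instance prodsym :: (countable, countable) countable
  by countable_datatype

definition prod_language :: "'s language \<Rightarrow> 't language \<Rightarrow> ('s, 't) prodsym language" where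
  "prod_language L1 L2 =
     \<lparr>rel_syms = {Both, Kernel1, Kernel2} \<union> Left ` rel_syms L1 \<union> Right ` rel_syms L2,
      fun_syms = {}, const_syms = {},
      rel_arity = (\<lambda>s. case s of Left r \<Rightarrow> rel_arity L1 r | Right r \<Rightarrow> rel_arity L2 r | _ \<Rightarrow> 2),
      fun_arity = (\<lambda>_. 1)\<rparr>"

lemma finite_prod_language:
  "finite_language L1 \<Longrightarrow> finite_language L2 \<Longrightarrow> finite_language (prod_language L1 L2)"
  by (auto simp: finite_language_def language_def prod_language_def)

text \<open>Exchanging the factors lets \<open>factor_rel\<close> describe both sides of a
  rectangle: the second factor under \<open>s\<close> behaves as a first factor under
  \<open>swap_sym s\<close>.\<close>

primrec swap_sym :: "('s, 't) prodsym \<Rightarrow> ('t, 's) prodsym" where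
  "swap_sym Both = Both"
| "swap_sym Kernel1 = Kernel2"
| "swap_sym Kernel2 = Kernel1"
| "swap_sym (Left r) = Right r"
| "swap_sym (Right r) = Left r"

lemma swap_sym_rel_syms:
  "s \<in> rel_syms (prod_language L1 L2) \<Longrightarrow> swap_sym s \<in> rel_syms (prod_language L2 L1)"
  by (auto simp: prod_language_def)

lemma rel_arity_swap_sym:
  "rel_arity (prod_language L2 L1) (swap_sym s) = rel_arity (prod_language L1 L2) s"
  by (cases s) (simp_all add: prod_language_def)

text \<open>The first side of the rectangle of \<open>s\<close>. For \<open>Kernel1\<close> it is
  the diagonal: two pairs have the same first projection iff their first coordinates agree. Symbols
  that leave this factor free (\<open>Kernel2\<close>, \<open>Right\<close>) give the full power;
  its exponent is passed as \<open>n\<close> because it may come from the other language.\<close>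

definition factor_rel :: "'s \<Rightarrow> ('s, 'a) topstruct \<Rightarrow> nat \<Rightarrow> ('s, 't) prodsym \<Rightarrow> (nat \<Rightarrow> 'a) set" where
  "factor_rel R A n s = (case s of
      Both \<Rightarrow> rel_of A R
    | Kernel1 \<Rightarrow> {u \<in> {..<2} \<rightarrow>\<^sub>E carrier_of A. u 0 = u 1}
    | Left r \<Rightarrow> rel_of A r
    | _ \<Rightarrow> {..<n} \<rightarrow>\<^sub>E carrier_of A)"

text \<open>Every symbol is interpreted as a rectangle: \<open>Both\<close> is the coordinatewise distinguished
  relation, \<open>Kernel1\<close> and \<open>Kernel2\<close> are the kernels of the two projections, and the symbols of
  either factor constrain that factor only. The map \<open>e\<close> encodes pairs.\<close>

definition prod_structure ::
    "('a \<times> 'b \<Rightarrow> 'c) \<Rightarrow> 's language \<Rightarrow> 's \<Rightarrow> 't language \<Rightarrow> 't \<Rightarrow>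
     ('s, 'a) topstruct \<Rightarrow> ('t, 'b) topstruct \<Rightarrow> (('s, 't) prodsym, 'c) topstruct" where
  "prod_structure e L1 R1 L2 R2 A B =
     \<lparr>space_of = prod_space e (space_of A) (space_of B),
      rel_of = (\<lambda>s. let n = rel_arity (prod_language L1 L2) s
                    in rect e n (factor_rel R1 A n s) (factor_rel R2 B n (swap_sym s))),
      fun_of = (\<lambda>_ _. undefined), const_of = (\<lambda>_. undefined)\<rparr>"

lemma space_of_prod_structure [simp]:
  "space_of (prod_structure e L1 R1 L2 R2 A B) = prod_space e (space_of A) (space_of B)"
  by (simp add: prod_structure_def)

lemma compose_image_PiE:
  assumes "f ` A = B"
  shows "compose {..<n::nat} f ` ({..<n} \<rightarrow>\<^sub>E A) = {..<n} \<rightarrow>\<^sub>E B"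
proof
  show "compose {..<n} f ` ({..<n} \<rightarrow>\<^sub>E A) \<subseteq> {..<n} \<rightarrow>\<^sub>E B"
    using assms by (auto simp: compose_def)
  show "{..<n} \<rightarrow>\<^sub>E B \<subseteq> compose {..<n} f ` ({..<n} \<rightarrow>\<^sub>E A)"
  proof
    fix v assume v: "v \<in> {..<n} \<rightarrow>\<^sub>E B"
    then have "v i \<in> f ` A" if "i < n" for i using that assms by (simp add: PiE_iff)
    then obtain b where b: "\<And>i. i < n \<Longrightarrow> b i \<in> A \<and> f (b i) = v i"
      unfolding image_iff by metis
    have "compose {..<n} f (restrict b {..<n}) = v"
      using v b by (auto simp: fun_eq_iff compose_def PiE_iff extensional_def)
    moreover have "restrict b {..<n} \<in> {..<n} \<rightarrow>\<^sub>E A" using b by auto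
    ultimately show "v \<in> compose {..<n} f ` ({..<n} \<rightarrow>\<^sub>E A)" by blast
  qed
qed

text \<open>With the diagonal written as the set of constant tuples, its image under a surjection is
  just a composition of images.\<close>

lemma diagonal_eq_image:
  "{u \<in> {..<2::nat} \<rightarrow>\<^sub>E C. u 0 = u 1} = (\<lambda>c. \<lambda>i\<in>{..<2}. c) ` C"
proof
  show "{u \<in> {..<2::nat} \<rightarrow>\<^sub>E C. u 0 = u 1} \<subseteq> (\<lambda>c. \<lambda>i\<in>{..<2}. c) ` C"
  proof
    fix u assume "u \<in> {u \<in> {..<2::nat} \<rightarrow>\<^sub>E C. u 0 = u 1}"
    then have u: "u \<in> {..<2} \<rightarrow>\<^sub>E C" "u 1 = u 0" by simp_all
    then have "u = (\<lambda>i\<in>{..<2}. u 0)"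
      by (auto simp: fun_eq_iff PiE_iff extensional_def less_2_cases_iff)
    moreover have "u 0 \<in> C" by (rule PiE_mem[OF u(1)]) simp
    ultimately show "u \<in> (\<lambda>c. \<lambda>i\<in>{..<2}. c) ` C" by blast
  qed
qed (auto split: if_splits)

lemma compose_image_diagonal:
  assumes "f ` A = B"
  shows "compose {..<2::nat} f ` {u \<in> {..<2} \<rightarrow>\<^sub>E A. u 0 = u 1} = {u \<in> {..<2} \<rightarrow>\<^sub>E B. u 0 = u 1}"
proof -
  have "compose {..<2} f (\<lambda>i\<in>{..<2}. c) = (\<lambda>i\<in>{..<2::nat}. f c)" for c
    by (auto simp: compose_def fun_eq_iff)
  then have "compose {..<2::nat} f ` {u \<in> {..<2} \<rightarrow>\<^sub>E A. u 0 = u 1} = (\<lambda>c. \<lambda>i\<in>{..<2}. c) ` f ` A"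
    by (simp only: diagonal_eq_image image_image)
  then show ?thesis by (simp only: diagonal_eq_image assms)
qed

text \<open>Relations of \<open>L\<close> are handled by the definition of epimorphism, full powers
  and the diagonal by surjectivity. Through \<open>swap_sym\<close> the lemma also covers the second
  factor.\<close>

lemma compose_image_factor_rel:
  assumes "epimorphism L A C f" "R \<in> rel_syms L" "rel_arity L R = 2"
    and "s \<in> rel_syms (prod_language L L')"
  defines "n \<equiv> rel_arity (prod_language L L') s"
  shows "factor_rel R C n s = compose {..<n} f ` factor_rel R A n s"
proof -
  have im: "f ` carrier_of A = carrier_of C"
    and rel: "\<And>r. r \<in> rel_syms L \<Longrightarrow> rel_of C r = compose {..<rel_arity L r} f ` rel_of A r"
    using assms(1) by (auto simp: epimorphism_def)
  show ?thesis
    using assms(2-4) rel compose_image_PiE[OF im] compose_image_diagonal[OF im]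
    unfolding n_def by (cases s) (auto simp: prod_language_def factor_rel_def)
qed

lemma closedin_factor_rel:
  assumes A: "topological_structure L A" and "R \<in> rel_syms L" "rel_arity L R = 2"
    and s: "s \<in> rel_syms (prod_language L L')"
  defines "n \<equiv> rel_arity (prod_language L L') s"
  shows "closedin (power_topology n (space_of A)) (factor_rel R A n s)"
proof -
  have H: "Hausdorff_space (space_of A)"
    and rel: "\<And>r. r \<in> rel_syms L \<Longrightarrow> closedin (power_topology (rel_arity L r) (space_of A)) (rel_of A r)"
    using A by (auto simp: topological_structure_def)
  have "closedin (power_topology 2 (space_of A))
      {u \<in> topspace (power_topology 2 (space_of A)). u 0 = u 1}"
    by (rule closedin_continuous_maps_eq[OF H]; rule continuous_map_product_projection) auto
  then have diag: "closedin (power_topology 2 (space_of A)) {u \<in> {..<2} \<rightarrow>\<^sub>E carrier_of A. u 0 = u 1}"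
    by simp
  have full: "closedin (power_topology m (space_of A)) ({..<m} \<rightarrow>\<^sub>E carrier_of A)" for m
    using closedin_topspace[of "power_topology m (space_of A)"] by simp
  show ?thesis
    using s assms(2,3) rel[of R] rel diag full
    unfolding n_def by (cases s) (auto simp: prod_language_def factor_rel_def)
qed

section \<open>Epimorphisms between product structures\<close>

locale relational_pair =
  fixes L1 :: "'s language" and R1 :: 's and L2 :: "'t language" and R2 :: 't
  assumes R1: "R1 \<in> rel_syms L1" "rel_arity L1 R1 = 2"
    and R2: "R2 \<in> rel_syms L2" "rel_arity L2 R2 = 2"
    and relational: "fun_syms L1 = {}" "const_syms L1 = {}" "fun_syms L2 = {}" "const_syms L2 = {}"
begin

abbreviation prod_lang :: "('s, 't) prodsym language" where
  "prod_lang \<equiv> prod_language L1 L2"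

abbreviation prod_struct ::
    "('a \<times> 'b \<Rightarrow> 'c) \<Rightarrow> ('s, 'a) topstruct \<Rightarrow> ('t, 'b) topstruct \<Rightarrow> (('s, 't) prodsym, 'c) topstruct" where
  "prod_struct e \<equiv> prod_structure e L1 R1 L2 R2"

lemma rel_of_prod_struct:
  "rel_of (prod_struct e A B) s =
     rect e (rel_arity prod_lang s) (factor_rel R1 A (rel_arity prod_lang s) s)
       (factor_rel R2 B (rel_arity prod_lang s) (swap_sym s))"
  by (simp add: prod_structure_def Let_def)

lemma closedin_factors:
  assumes "topological_structure L1 A" "topological_structure L2 B" "s \<in> rel_syms prod_lang"
  shows "closedin (power_topology (rel_arity prod_lang s) (space_of A))
           (factor_rel R1 A (rel_arity prod_lang s) s)"
    and "closedin (power_topology (rel_arity prod_lang s) (space_of B))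
           (factor_rel R2 B (rel_arity prod_lang s) (swap_sym s))"
  using closedin_factor_rel[OF assms(1) R1 assms(3)]
    closedin_factor_rel[OF assms(2) R2 swap_sym_rel_syms[OF assms(3)]]
  by (simp_all add: rel_arity_swap_sym)

lemma factors_subset:
  assumes "topological_structure L1 A" "topological_structure L2 B" "s \<in> rel_syms prod_lang"
  shows "factor_rel R1 A (rel_arity prod_lang s) s \<subseteq> {..<rel_arity prod_lang s} \<rightarrow>\<^sub>E carrier_of A"
    and "factor_rel R2 B (rel_arity prod_lang s) (swap_sym s) \<subseteq> {..<rel_arity prod_lang s} \<rightarrow>\<^sub>E carrier_of B"
  using closedin_factors[OF assms, THEN closedin_subset] by simp_all

lemma topological_structure_prod:
  assumes A: "topological_structure L1 A" and B: "topological_structure L2 B" and e: "bij e"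
  shows "topological_structure prod_lang (prod_struct e A B)"
proof -
  note hom = prod_space_homeomorphic[OF e, of "space_of A" "space_of B"]
  have "prod_space e (space_of A) (space_of B) dim_le 0"
    using A B zero_dimensional_prod_topology homeomorphic_space_dimension_le[OF hom]
    by (auto simp: topological_structure_def)
  moreover have "compact_space (prod_space e (space_of A) (space_of B))"
    using A B homeomorphic_compact_space[OF hom]
    by (auto simp: topological_structure_def compact_space_prod_topology)
  moreover have "Hausdorff_space (prod_space e (space_of A) (space_of B))"
    using A B homeomorphic_Hausdorff_space[OF hom]
    by (auto simp: topological_structure_def Hausdorff_space_prod_topology)
  moreover have "second_countable (prod_space e (space_of A) (space_of B))"
    using A B homeomorphic_space_second_countable[OF hom] second_countable_prod_topology
    by (auto simp: topological_structure_def)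
  moreover have "\<forall>s\<in>rel_syms prod_lang.
      closedin (power_topology (rel_arity prod_lang s) (prod_space e (space_of A) (space_of B)))
        (rel_of (prod_struct e A B) s)"
    using closedin_factors[OF A B] closedin_rect[OF e] by (simp add: rel_of_prod_struct)
  moreover have "fun_syms prod_lang = {}" "const_syms prod_lang = {}"
    by (simp_all add: prod_language_def)
  ultimately show ?thesis
    unfolding topological_structure_def by simp
qed

lemma epimorphism_prod_map:
  assumes A: "topological_structure L1 A" and B: "topological_structure L2 B"
    and f: "epimorphism L1 A C f" and g: "epimorphism L2 B D g" and e: "bij e" "bij e'"
  shows "epimorphism prod_lang (prod_struct e A B) (prod_struct e' C D) (prod_map e e' f g)"
proof -
  have "rel_of (prod_struct e' C D) s =
      compose {..<rel_arity prod_lang s} (prod_map e e' f g) ` rel_of (prod_struct e A B) s"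
    if s: "s \<in> rel_syms prod_lang" for s
  proof -
    let ?n = "rel_arity prod_lang s"
    have "factor_rel R1 C ?n s = compose {..<?n} f ` factor_rel R1 A ?n s"
      by (rule compose_image_factor_rel[OF f R1 s])
    moreover have "factor_rel R2 D ?n (swap_sym s) = compose {..<?n} g ` factor_rel R2 B ?n (swap_sym s)"
      using compose_image_factor_rel[OF g R2 swap_sym_rel_syms[OF s]] by (simp add: rel_arity_swap_sym)
    moreover have "compose {..<?n} (prod_map e e' f g) ` rect e ?n (factor_rel R1 A ?n s) (factor_rel R2 B ?n (swap_sym s))
       = rect e' ?n (compose {..<?n} f ` factor_rel R1 A ?n s) (compose {..<?n} g ` factor_rel R2 B ?n (swap_sym s))"
      by (rule compose_image_rect[OF factors_subset[OF A B s]]) (use e in simp)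
    ultimately show ?thesis by (simp add: rel_of_prod_struct)
  qed
  moreover have "continuous_map (prod_space e (space_of A) (space_of B))
      (prod_space e' (space_of C) (space_of D)) (prod_map e e' f g)"
    using f g e by (intro continuous_map_prod_map) (auto simp: epimorphism_def)
  moreover have "prod_map e e' f g ` topspace (prod_space e (space_of A) (space_of B)) =
      topspace (prod_space e' (space_of C) (space_of D))"
  proof -
    have "f ` carrier_of A = carrier_of C" "g ` carrier_of B = carrier_of D"
      using f g by (auto simp: epimorphism_def)
    then have "map_prod f g ` (carrier_of A \<times> carrier_of B) = carrier_of C \<times> carrier_of D"
      by (simp add: map_prod_surj_on)
    moreover have "inv e ` e ` (carrier_of A \<times> carrier_of B) = carrier_of A \<times> carrier_of B"
      using e(1) by (simp add: bij_is_inj image_inv_f_f)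
    ultimately show ?thesis
      by (simp only: topspace_prod_space[OF e(1)] topspace_prod_space[OF e(2)] prod_map_def image_comp[symmetric])
  qed
  ultimately show ?thesis
    unfolding epimorphism_def by (simp add: prod_language_def)
qed

text \<open>Pairs with equal first coordinates are related by \<open>Kernel1\<close>, hence so are
  their images; thus the first coordinate of \<open>\<phi> (e (a, b))\<close> does not depend on
  \<open>b\<close>, and symmetrically for \<open>Kernel2\<close>. The resulting \<open>f\<close> and
  \<open>g\<close> are continuous as slices of \<open>\<phi>\<close>, and they preserve relations
  because rectangles can be cancelled.\<close>

lemma epimorphism_prod_decompose:
  assumes A: "topological_structure L1 A" and B: "topological_structure L2 B"
    and C: "topological_structure L1 C" and D: "topological_structure L2 D"
    and e: "bij e" "bij e'" and ne: "carrier_of A \<noteq> {}" "carrier_of B \<noteq> {}"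
    and \<phi>: "epimorphism prod_lang (prod_struct e A B) (prod_struct e' C D) \<phi>"
  obtains f g where "epimorphism L1 A C f" "epimorphism L2 B D g"
    "\<forall>z\<in>carrier_of (prod_struct e A B). \<phi> z = prod_map e e' f g z"
proof -
  have cont: "continuous_map (prod_space e (space_of A) (space_of B))
      (prod_space e' (space_of C) (space_of D)) \<phi>"
    and im: "\<phi> ` topspace (prod_space e (space_of A) (space_of B)) =
      topspace (prod_space e' (space_of C) (space_of D))"
    and rel: "\<And>s. s \<in> rel_syms prod_lang \<Longrightarrow> rel_of (prod_struct e' C D) s =
      compose {..<rel_arity prod_lang s} \<phi> ` rel_of (prod_struct e A B) s"
    using \<phi> by (auto simp: epimorphism_def)
  obtain a0 b0 where a0: "a0 \<in> carrier_of A" and b0: "b0 \<in> carrier_of B" using ne by blast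
  define \<phi>1 where "\<phi>1 a b = fst (inv e' (\<phi> (e (a, b))))" for a b
  define \<phi>2 where "\<phi>2 a b = snd (inv e' (\<phi> (e (a, b))))" for a b
  define f where "f a = \<phi>1 a b0" for a
  define g where "g b = \<phi>2 a0 b" for b
  have \<phi>_eq: "\<phi> (e (a, b)) = e' (\<phi>1 a b, \<phi>2 a b)" for a b
    using e(2) by (simp add: \<phi>1_def \<phi>2_def bij_is_surj surj_f_inv_f)
  \<comment> \<open>Both kernels at once: the image of a kernel pair is again a pair in that kernel,
    and its sides \<open>s\<close>, \<open>t\<close> are the coordinates of \<open>\<phi>\<close> at
    positions 0 and 1.\<close>
  have kernel: "\<exists>s t. s \<in> factor_rel R1 C 2 k \<and> t \<in> factor_rel R2 D 2 (swap_sym k) \<and>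
      s 0 = \<phi>1 (u 0) (v 0) \<and> t 0 = \<phi>2 (u 0) (v 0) \<and> s 1 = \<phi>1 (u 1) (v 1) \<and> t 1 = \<phi>2 (u 1) (v 1)"
    if k: "k = Kernel1 \<or> k = Kernel2" and uv: "u \<in> factor_rel R1 A 2 k" "v \<in> factor_rel R2 B 2 (swap_sym k)"
    for k u v
  proof -
    have ks: "k \<in> rel_syms prod_lang" and [simp]: "rel_arity prod_lang k = 2"
      using k by (auto simp: prod_language_def)
    have "compose {..<2} \<phi> (pair_tuple e 2 u v) \<in> rel_of (prod_struct e' C D) k"
      using rel[OF ks] rectI[OF uv, of e 2] by (simp add: rel_of_prod_struct)
    then obtain s t where st: "s \<in> factor_rel R1 C 2 k" "t \<in> factor_rel R2 D 2 (swap_sym k)"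
        "compose {..<2} \<phi> (pair_tuple e 2 u v) = pair_tuple e' 2 s t"
      by (auto simp: rel_of_prod_struct rect_def)
    have "e' (\<phi>1 (u i) (v i), \<phi>2 (u i) (v i)) = e' (s i, t i)" if "i < 2" for i
      using fun_cong[OF st(3), of i] that by (simp add: compose_def pair_tuple_def \<phi>_eq)
    then have "\<phi>1 (u i) (v i) = s i \<and> \<phi>2 (u i) (v i) = t i" if "i < 2" for i
      using that injD[OF bij_is_inj[OF e(2)]] by blast
    from this[of 0] this[of 1] st(1,2) show ?thesis by auto
  qed
  have \<phi>1: "\<phi>1 a b = f a" if "a \<in> carrier_of A" "b \<in> carrier_of B" for a b
  proof -
    \<comment> \<open>Together these tuples encode the pair \<open>(a, b)\<close>,
      \<open>(a, b0)\<close>, which lies in the kernel of the first projection.\<close>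
    have "(\<lambda>i\<in>{..<2}. a) \<in> factor_rel R1 A 2 (Kernel1 :: ('s, 't) prodsym)"
      "(\<lambda>i\<in>{..<2}. if i = 0 then b else b0) \<in> factor_rel R2 B 2 (swap_sym (Kernel1 :: ('s, 't) prodsym))"
      using that b0 by (simp_all add: factor_rel_def)
    from kernel[OF disjI1[OF refl] this]
    obtain s where s: "s \<in> factor_rel R1 C 2 (Kernel1 :: ('s, 't) prodsym)" "s 0 = \<phi>1 a b" "s 1 = \<phi>1 a b0"
      by (elim exE conjE) simp
    have "s 0 = s 1" using s(1) by (simp add: factor_rel_def)
    then show ?thesis unfolding s(2,3) f_def .
  qed
  have \<phi>2: "\<phi>2 a b = g b" if "a \<in> carrier_of A" "b \<in> carrier_of B" for a b
  proof -
    \<comment> \<open>The same for \<open>(a, b)\<close> and \<open>(a0, b)\<close>, which agree in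
      the second coordinate.\<close>
    have "(\<lambda>i\<in>{..<2}. if i = 0 then a else a0) \<in> factor_rel R1 A 2 (Kernel2 :: ('s, 't) prodsym)"
      "(\<lambda>i\<in>{..<2}. b) \<in> factor_rel R2 B 2 (swap_sym (Kernel2 :: ('s, 't) prodsym))"
      using that a0 by (simp_all add: factor_rel_def)
    from kernel[OF disjI2[OF refl] this]
    obtain t where t: "t \<in> factor_rel R2 D 2 (Kernel1 :: ('t, 's) prodsym)" "t 0 = \<phi>2 a b" "t 1 = \<phi>2 a0 b"
      by (elim exE conjE) simp
    have "t 0 = t 1" using t(1) by (simp add: factor_rel_def)
    then show ?thesis unfolding t(2,3) g_def .
  qed
  have fg: "\<phi> (e (a, b)) = e' (f a, g b)" if "a \<in> carrier_of A" "b \<in> carrier_of B" for a b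
    using that \<phi>1 \<phi>2 \<phi>_eq by simp
  have eqmap: "\<phi> z = prod_map e e' f g z" if "z \<in> carrier_of (prod_struct e A B)" for z
    using that fg e by (auto simp: topspace_prod_space)
  have ce: "continuous_map (prod_topology (space_of A) (space_of B)) (prod_topology (space_of C) (space_of D))
      (inv e' \<circ> \<phi> \<circ> e)"
    using homeomorphic_maps_prod_space[OF e(1)] homeomorphic_maps_prod_space[OF e(2)] cont
    by (intro continuous_map_compose) (auto simp: homeomorphic_maps_def intro: continuous_map_compose)
  have contf: "continuous_map (space_of A) (space_of C) f"
  proof -
    have "continuous_map (space_of A) (prod_topology (space_of A) (space_of B)) (\<lambda>a. (a, b0))"
      using b0 by (simp add: continuous_map_pairedI)
    from continuous_map_compose[OF continuous_map_compose[OF this ce] continuous_map_fst]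
    show ?thesis by (simp add: o_def f_def[abs_def] \<phi>1_def)
  qed
  have contg: "continuous_map (space_of B) (space_of D) g"
  proof -
    have "continuous_map (space_of B) (prod_topology (space_of A) (space_of B)) (\<lambda>b. (a0, b))"
      using a0 by (simp add: continuous_map_pairedI)
    from continuous_map_compose[OF continuous_map_compose[OF this ce] continuous_map_snd]
    show ?thesis by (simp add: o_def g_def[abs_def] \<phi>2_def)
  qed
  have fC: "f a \<in> carrier_of C" if "a \<in> carrier_of A" for a
    using continuous_map_funspace[OF contf] that by auto
  have gD: "g b \<in> carrier_of D" if "b \<in> carrier_of B" for b
    using continuous_map_funspace[OF contg] that by auto
  \<comment> \<open>Surjectivity of \<open>\<phi>\<close> provides a joint preimage of
    \<open>c\<close> and \<open>d\<close>. Taking \<open>d = g b0\<close>, respectively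
    \<open>c = f a0\<close>, separates it into surjectivity of \<open>f\<close> and of
    \<open>g\<close>.\<close>
  have pre: "\<exists>a\<in>carrier_of A. \<exists>b\<in>carrier_of B. c = f a \<and> d = g b"
    if "c \<in> carrier_of C" "d \<in> carrier_of D" for c d
  proof -
    have "e' (c, d) \<in> \<phi> ` e ` (carrier_of A \<times> carrier_of B)"
      using im that by (simp add: topspace_prod_space e)
    then obtain a b where "a \<in> carrier_of A" "b \<in> carrier_of B" "e' (c, d) = e' (f a, g b)"
      using fg by auto
    then show ?thesis using injD[OF bij_is_inj[OF e(2)]] by blast
  qed
  have imf: "f ` carrier_of A = carrier_of C"
    using fC pre[OF _ gD[OF b0]] by blast
  have img: "g ` carrier_of B = carrier_of D"
    using gD pre[OF fC[OF a0]] by blast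
  have rect_eq: "rect e' (rel_arity prod_lang s) (factor_rel R1 C (rel_arity prod_lang s) s)
        (factor_rel R2 D (rel_arity prod_lang s) (swap_sym s)) =
      rect e' (rel_arity prod_lang s) (compose {..<rel_arity prod_lang s} f ` factor_rel R1 A (rel_arity prod_lang s) s)
        (compose {..<rel_arity prod_lang s} g ` factor_rel R2 B (rel_arity prod_lang s) (swap_sym s))"
    if s: "s \<in> rel_syms prod_lang" for s
    using rel[OF s] compose_image_rect[OF factors_subset[OF A B s], of \<phi> e e' f g] fg
    by (simp add: rel_of_prod_struct)
  have relf: "rel_of C r = compose {..<rel_arity L1 r} f ` rel_of A r" if r: "r \<in> rel_syms L1" for r
  proof -
    have s: "Left r \<in> rel_syms prod_lang" and n: "rel_arity prod_lang (Left r) = rel_arity L1 r"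
      using r by (auto simp: prod_language_def)
    \<comment> \<open>In the rectangles of \<open>Left r\<close> the second sides are a full power
      and the image of one. They have points because of \<open>b0\<close>, so they can be
      cancelled.\<close>
    show ?thesis
    proof (rule rect_inject(1)[OF bij_is_inj[OF e(2)] _ _ _ _ rect_eq[OF s, unfolded n factor_rel_def swap_sym.simps prodsym.case]])
      show "rel_of C r \<subseteq> {..<rel_arity L1 r} \<rightarrow>\<^sub>E carrier_of C"
        using factors_subset(1)[OF C D s] by (simp add: n factor_rel_def)
      show "compose {..<rel_arity L1 r} f ` rel_of A r \<subseteq> {..<rel_arity L1 r} \<rightarrow>\<^sub>E carrier_of C"
        using image_mono[OF factors_subset(1)[OF A B s], of "compose {..<rel_arity L1 r} f"]
        by (simp add: n factor_rel_def compose_image_PiE[OF imf])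
      show "compose {..<rel_arity L1 r} g ` ({..<rel_arity L1 r} \<rightarrow>\<^sub>E carrier_of B)
          \<subseteq> {..<rel_arity L1 r} \<rightarrow>\<^sub>E carrier_of D"
        by (simp add: compose_image_PiE[OF img])
      show "({..<rel_arity L1 r} \<rightarrow>\<^sub>E carrier_of D) \<noteq> {}"
        using gD[OF b0] by (auto simp: PiE_eq_empty_iff)
      show "compose {..<rel_arity L1 r} g ` ({..<rel_arity L1 r} \<rightarrow>\<^sub>E carrier_of B) \<noteq> {}"
        using b0 by (auto simp: PiE_eq_empty_iff)
    qed simp
  qed
  have relg: "rel_of D r = compose {..<rel_arity L2 r} g ` rel_of B r" if r: "r \<in> rel_syms L2" for r
  proof -
    have s: "Right r \<in> rel_syms prod_lang" and n: "rel_arity prod_lang (Right r) = rel_arity L2 r"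
      using r by (auto simp: prod_language_def)
    show ?thesis
    proof (rule rect_inject(2)[OF bij_is_inj[OF e(2)] _ _ _ _ rect_eq[OF s, unfolded n factor_rel_def swap_sym.simps prodsym.case]])
      show "rel_of D r \<subseteq> {..<rel_arity L2 r} \<rightarrow>\<^sub>E carrier_of D"
        using factors_subset(2)[OF C D s] by (simp add: n factor_rel_def)
      show "compose {..<rel_arity L2 r} g ` rel_of B r \<subseteq> {..<rel_arity L2 r} \<rightarrow>\<^sub>E carrier_of D"
        using image_mono[OF factors_subset(2)[OF A B s], of "compose {..<rel_arity L2 r} g"]
        by (simp add: n factor_rel_def compose_image_PiE[OF img])
      show "compose {..<rel_arity L2 r} f ` ({..<rel_arity L2 r} \<rightarrow>\<^sub>E carrier_of A)
          \<subseteq> {..<rel_arity L2 r} \<rightarrow>\<^sub>E carrier_of C"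
        by (simp add: compose_image_PiE[OF imf])
      show "({..<rel_arity L2 r} \<rightarrow>\<^sub>E carrier_of C) \<noteq> {}"
        using fC[OF a0] by (auto simp: PiE_eq_empty_iff)
      show "compose {..<rel_arity L2 r} f ` ({..<rel_arity L2 r} \<rightarrow>\<^sub>E carrier_of A) \<noteq> {}"
        using a0 by (auto simp: PiE_eq_empty_iff)
    qed simp
  qed
  \<comment> \<open>The product language has relation symbols only; the clauses for functions and
    constants hold by \<open>relational\<close>.\<close>
  have "epimorphism L1 A C f" "epimorphism L2 B D g"
    using contf contg imf img relf relg relational by (auto simp: epimorphism_def)
  then show thesis using eqmap that by blast
qed

end

section \<open>Products of Fraisse families and limits\<close>

lemma projective_Fraisse_limit_factor:
  assumes M: "projective_Fraisse_limit L \<F> M"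
    and f: "finite (A :: nat set)" "continuous_map (space_of M) (discrete_topology A) f"
  shows "\<exists>D\<in>\<F>. \<exists>\<phi> f'. epimorphism L M D \<phi> \<and> f' ` carrier_of D \<subseteq> A \<and>
    (\<forall>x\<in>carrier_of M. f x = f' (\<phi> x))"
  by (rule M[unfolded projective_Fraisse_limit_def, THEN conjunct2, THEN conjunct2, THEN conjunct1,
        rule_format, OF conjI[OF f]])

lemma epimorphism_in_carrier:
  assumes "epimorphism L A B \<phi>" "x \<in> carrier_of A"
  shows "\<phi> x \<in> carrier_of B"
proof -
  have "\<phi> ` carrier_of A = carrier_of B" using assms(1) by (simp add: epimorphism_def)
  then show ?thesis using assms(2) by blast
qed

text \<open>Carries non-emptiness from the limit to the members of the family, where splitting an
  epimorphism requires base points.\<close>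

lemma projective_Fraisse_limit_nonempty:
  assumes "projective_Fraisse_limit L \<F> M" "D \<in> \<F>" "carrier_of M \<noteq> {}"
  shows "carrier_of D \<noteq> {}"
proof -
  obtain \<phi> where "epimorphism L M D \<phi>"
    using assms(1,2) by (auto simp: projective_Fraisse_limit_def)
  then have "\<phi> ` carrier_of M = carrier_of D" by (simp add: epimorphism_def)
  then show ?thesis using assms(3) by (metis image_is_empty)
qed

lemma projective_Fraisse_limit_homogeneous:
  assumes M: "projective_Fraisse_limit L \<F> M" and D: "D \<in> \<F>"
    and \<phi>: "epimorphism L M D \<phi>\<^sub>1" "epimorphism L M D \<phi>\<^sub>2"
  shows "\<exists>\<psi>. isomorphism L M M \<psi> \<and> (\<forall>x\<in>carrier_of M. \<phi>\<^sub>2 x = \<phi>\<^sub>1 (\<psi> x))"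
  by (rule M[unfolded projective_Fraisse_limit_def, THEN conjunct2, THEN conjunct2, THEN conjunct2,
        rule_format, OF D conjI[OF \<phi>]])

lemma projective_Fraisse_family_amalgam:
  assumes F: "projective_Fraisse_family L \<F>" and mem: "C \<in> \<F>" "D \<in> \<F>" "E \<in> \<F>"
    and \<phi>: "epimorphism L D C \<phi>\<^sub>1" "epimorphism L E C \<phi>\<^sub>2"
  shows "\<exists>F\<in>\<F>. \<exists>\<psi>\<^sub>1 \<psi>\<^sub>2. epimorphism L F D \<psi>\<^sub>1 \<and> epimorphism L F E \<psi>\<^sub>2 \<and>
    (\<forall>x\<in>carrier_of F. \<phi>\<^sub>1 (\<psi>\<^sub>1 x) = \<phi>\<^sub>2 (\<psi>\<^sub>2 x))"
  by (rule F[unfolded projective_Fraisse_family_def, THEN conjunct2, THEN conjunct2,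
        rule_format, OF mem conjI[OF \<phi>]])

context relational_pair
begin

lemma isomorphism_prod_map:
  assumes A: "topological_structure L1 A" and B: "topological_structure L2 B"
    and f: "isomorphism L1 A A f" and g: "isomorphism L2 B B g" and e: "bij e"
  shows "isomorphism prod_lang (prod_struct e A B) (prod_struct e A B) (prod_map e e f g)"
proof -
  have epi: "epimorphism prod_lang (prod_struct e A B) (prod_struct e A B) (prod_map e e f g)"
    using f g e by (intro epimorphism_prod_map[OF A B]) (auto simp: isomorphism_def)
  have inj: "inj_on f (carrier_of A)" "inj_on g (carrier_of B)"
    using f g by (auto simp: isomorphism_def bij_betw_def)
  have "inj_on (prod_map e e f g) (e ` (carrier_of A \<times> carrier_of B))"
  proof (rule inj_onI)
    fix z z' assume "z \<in> e ` (carrier_of A \<times> carrier_of B)" "z' \<in> e ` (carrier_of A \<times> carrier_of B)"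
      and eq: "prod_map e e f g z = prod_map e e f g z'"
    then obtain a b a' b' where z: "z = e (a, b)" "z' = e (a', b')" "a \<in> carrier_of A" "a' \<in> carrier_of A"
        "b \<in> carrier_of B" "b' \<in> carrier_of B" by auto
    then have "(f a, g b) = (f a', g b')"
      using eq e by (intro injD[OF bij_is_inj[OF e]]) simp
    then show "z = z'" using z inj by (simp add: inj_on_eq_iff)
  qed
  then show ?thesis
    using epi unfolding isomorphism_def
    by (simp add: bij_betw_def epimorphism_def topspace_prod_space[OF e])
qed

text \<open>Joint projections and amalgams are formed in each factor. For amalgamation the two given
  epimorphisms must be split first, hence the non-empty carriers.\<close>

lemma projective_Fraisse_family_prod:
  assumes F1: "projective_Fraisse_family L1 \<F>1" and F2: "projective_Fraisse_family L2 \<F>2"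
    and ne1: "\<And>D. D \<in> \<F>1 \<Longrightarrow> carrier_of D \<noteq> {}" and ne2: "\<And>D. D \<in> \<F>2 \<Longrightarrow> carrier_of D \<noteq> {}"
    and e: "bij e"
  shows "projective_Fraisse_family prod_lang ((\<lambda>(D, E). prod_struct e D E) ` (\<F>1 \<times> \<F>2))"
proof -
  let ?\<F> = "(\<lambda>(D, E). prod_struct e D E) ` (\<F>1 \<times> \<F>2)"
  have top1: "\<And>D. D \<in> \<F>1 \<Longrightarrow> topological_structure L1 D"
    and top2: "\<And>D. D \<in> \<F>2 \<Longrightarrow> topological_structure L2 D"
    using F1 F2 by (auto simp: projective_Fraisse_family_def)
  have jpp: "\<exists>F\<in>?\<F>. (\<exists>\<phi>. epimorphism prod_lang F D \<phi>) \<and> (\<exists>\<phi>. epimorphism prod_lang F E \<phi>)"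
    if mem: "D \<in> ?\<F>" "E \<in> ?\<F>" for D E
  proof -
    obtain D1 D2 E1 E2 where DE: "D = prod_struct e D1 D2" "E = prod_struct e E1 E2"
        "D1 \<in> \<F>1" "D2 \<in> \<F>2" "E1 \<in> \<F>1" "E2 \<in> \<F>2"
      using mem by auto
    obtain G1 f1 g1 where G1: "G1 \<in> \<F>1" "epimorphism L1 G1 D1 f1" "epimorphism L1 G1 E1 g1"
      using F1 DE(3,5) unfolding projective_Fraisse_family_def by meson
    obtain G2 f2 g2 where G2: "G2 \<in> \<F>2" "epimorphism L2 G2 D2 f2" "epimorphism L2 G2 E2 g2"
      using F2 DE(4,6) unfolding projective_Fraisse_family_def by meson
    have "epimorphism prod_lang (prod_struct e G1 G2) D (prod_map e e f1 f2)"
        "epimorphism prod_lang (prod_struct e G1 G2) E (prod_map e e g1 g2)"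
      unfolding DE using G1 G2 top1 top2 e by (auto intro!: epimorphism_prod_map)
    moreover have "prod_struct e G1 G2 \<in> ?\<F>" using G1(1) G2(1) by auto
    ultimately show ?thesis by blast
  qed
  have ap: "\<exists>F\<in>?\<F>. \<exists>\<psi>\<^sub>1 \<psi>\<^sub>2. epimorphism prod_lang F D \<psi>\<^sub>1 \<and> epimorphism prod_lang F E \<psi>\<^sub>2 \<and>
           (\<forall>x\<in>carrier_of F. \<phi>\<^sub>1 (\<psi>\<^sub>1 x) = \<phi>\<^sub>2 (\<psi>\<^sub>2 x))"
    if in\<F>: "C \<in> ?\<F>" "D \<in> ?\<F>" "E \<in> ?\<F>" and \<phi>: "epimorphism prod_lang D C \<phi>\<^sub>1" "epimorphism prod_lang E C \<phi>\<^sub>2"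
    for C D E \<phi>\<^sub>1 \<phi>\<^sub>2
  proof -
    obtain C1 C2 D1 D2 E1 E2 where CDE: "C = prod_struct e C1 C2" "D = prod_struct e D1 D2"
        "E = prod_struct e E1 E2"
      and mem: "C1 \<in> \<F>1" "C2 \<in> \<F>2" "D1 \<in> \<F>1" "D2 \<in> \<F>2" "E1 \<in> \<F>1" "E2 \<in> \<F>2"
      using in\<F> by auto
    obtain f1 f2 where f: "epimorphism L1 D1 C1 f1" "epimorphism L2 D2 C2 f2"
        "\<forall>z\<in>carrier_of D. \<phi>\<^sub>1 z = prod_map e e f1 f2 z"
      using epimorphism_prod_decompose[OF top1[OF mem(3)] top2[OF mem(4)] top1[OF mem(1)] top2[OF mem(2)]
          e e ne1[OF mem(3)] ne2[OF mem(4)] \<phi>(1)[unfolded CDE]] CDE(2) by blast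
    obtain g1 g2 where g: "epimorphism L1 E1 C1 g1" "epimorphism L2 E2 C2 g2"
        "\<forall>z\<in>carrier_of E. \<phi>\<^sub>2 z = prod_map e e g1 g2 z"
      using epimorphism_prod_decompose[OF top1[OF mem(5)] top2[OF mem(6)] top1[OF mem(1)] top2[OF mem(2)]
          e e ne1[OF mem(5)] ne2[OF mem(6)] \<phi>(2)[unfolded CDE]] CDE(3) by blast
    obtain G1 h1 k1 where G1: "G1 \<in> \<F>1" "epimorphism L1 G1 D1 h1" "epimorphism L1 G1 E1 k1"
        "\<forall>x\<in>carrier_of G1. f1 (h1 x) = g1 (k1 x)"
      using projective_Fraisse_family_amalgam[OF F1 mem(1,3,5) f(1) g(1)] by blast
    obtain G2 h2 k2 where G2: "G2 \<in> \<F>2" "epimorphism L2 G2 D2 h2" "epimorphism L2 G2 E2 k2"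
        "\<forall>x\<in>carrier_of G2. f2 (h2 x) = g2 (k2 x)"
      using projective_Fraisse_family_amalgam[OF F2 mem(2,4,6) f(2) g(2)] by blast
    let ?G = "prod_struct e G1 G2"
    have epi: "epimorphism prod_lang ?G D (prod_map e e h1 h2)"
        "epimorphism prod_lang ?G E (prod_map e e k1 k2)"
      unfolding CDE using G1 G2 top1 top2 e by (auto intro!: epimorphism_prod_map)
    have "\<phi>\<^sub>1 (prod_map e e h1 h2 x) = \<phi>\<^sub>2 (prod_map e e k1 k2 x)" if x: "x \<in> carrier_of ?G" for x
    proof -
      obtain a b where ab: "x = e (a, b)" "a \<in> carrier_of G1" "b \<in> carrier_of G2"
        using x by (auto simp: topspace_prod_space[OF e])
      \<comment> \<open>The splittings of \<open>\<phi>\<^sub>1\<close> and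
        \<open>\<phi>\<^sub>2\<close> are known only on carriers, so the points to which they are
        applied must be placed there.\<close>
      have "prod_map e e h1 h2 x \<in> carrier_of D" "prod_map e e k1 k2 x \<in> carrier_of E"
        using epi[THEN epimorphism_in_carrier, OF x] .
      then show ?thesis
        using f(3) g(3) ab G1(4) G2(4) e by simp
    qed
    moreover have "?G \<in> ?\<F>" using G1(1) G2(1) by auto
    ultimately show ?thesis using epi by blast
  qed
  show ?thesis
    unfolding projective_Fraisse_family_def
  proof (intro conjI ballI allI impI)
    fix D assume "D \<in> ?\<F>"
    then show "topological_structure prod_lang D"
      using top1 top2 e by (auto intro: topological_structure_prod)
  qed (rule jpp ap; (elim conjE)?; assumption)+
qed

text \<open>(L1) is immediate from the factors, (L3) follows after splitting both epimorphisms, and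
  (L2) rests on \<open>continuous_map_prod_discrete_factor\<close>. There are two encodings because
  family and limit live on different carrier types.\<close>

lemma projective_Fraisse_limit_prod:
  assumes M1: "projective_Fraisse_limit L1 \<F>1 M1" and M2: "projective_Fraisse_limit L2 \<F>2 M2"
    and top1: "\<And>D. D \<in> \<F>1 \<Longrightarrow> topological_structure L1 D"
    and top2: "\<And>D. D \<in> \<F>2 \<Longrightarrow> topological_structure L2 D"
    and ne: "carrier_of M1 \<noteq> {}" "carrier_of M2 \<noteq> {}"
    and e: "bij e" "bij e'"
  shows "projective_Fraisse_limit prod_lang ((\<lambda>(D, E). prod_struct e D E) ` (\<F>1 \<times> \<F>2)) (prod_struct e' M1 M2)"
proof -
  let ?\<F> = "(\<lambda>(D, E). prod_struct e D E) ` (\<F>1 \<times> \<F>2)" and ?M = "prod_struct e' M1 M2"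
  have topM1: "topological_structure L1 M1" and topM2: "topological_structure L2 M2"
    using M1 M2 by (auto simp: projective_Fraisse_limit_def)
  have l1: "\<exists>\<phi>. epimorphism prod_lang ?M D \<phi>" if mem: "D \<in> ?\<F>" for D
  proof -
    obtain D1 D2 where D: "D = prod_struct e D1 D2" "D1 \<in> \<F>1" "D2 \<in> \<F>2" using mem by auto
    obtain f g where "epimorphism L1 M1 D1 f" "epimorphism L2 M2 D2 g"
      using M1 M2 D unfolding projective_Fraisse_limit_def by meson
    then show ?thesis
      unfolding D(1) using epimorphism_prod_map[OF topM1 topM2 _ _ e(2,1)] by blast
  qed
  have l2: "\<exists>D\<in>?\<F>. \<exists>\<phi> f'. epimorphism prod_lang ?M D \<phi> \<and> f' ` carrier_of D \<subseteq> A \<and>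
           (\<forall>x\<in>carrier_of ?M. f x = f' (\<phi> x))"
    if f: "continuous_map (space_of ?M) (discrete_topology A) f" for A :: "nat set" and f
  proof -
    have "continuous_map (prod_topology (space_of M1) (space_of M2)) (discrete_topology A) (f \<circ> e')"
      using f homeomorphic_maps_prod_space[OF e(2), of "space_of M1" "space_of M2"]
      by (auto simp: homeomorphic_maps_def intro: continuous_map_compose)
    then obtain B :: "nat set" and g h where B: "finite B"
      "continuous_map (space_of M1) (discrete_topology B) g"
      "continuous_map (space_of M2) (discrete_topology B) h"
      and gh: "\<forall>x\<in>carrier_of M1. \<forall>y\<in>carrier_of M2. \<forall>x'\<in>carrier_of M1. \<forall>y'\<in>carrier_of M2.
        g x = g x' \<longrightarrow> h y = h y' \<longrightarrow> (f \<circ> e') (x, y) = (f \<circ> e') (x', y')"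
      using topM1 topM2 unfolding topological_structure_def
      by (elim conjE) (rule continuous_map_prod_discrete_factor[of "space_of M1" "space_of M2" A "f \<circ> e'"])
    obtain D1 \<phi>1 g' where D1: "D1 \<in> \<F>1" "epimorphism L1 M1 D1 \<phi>1" "\<forall>x\<in>carrier_of M1. g x = g' (\<phi>1 x)"
      using projective_Fraisse_limit_factor[OF M1 B(1,2)] by blast
    obtain D2 \<phi>2 h' where D2: "D2 \<in> \<F>2" "epimorphism L2 M2 D2 \<phi>2" "\<forall>x\<in>carrier_of M2. h x = h' (\<phi>2 x)"
      using projective_Fraisse_limit_factor[OF M2 B(1,3)] by blast
    let ?\<phi> = "prod_map e' e \<phi>1 \<phi>2" and ?D = "prod_struct e D1 D2"
    have epi: "epimorphism prod_lang ?M ?D ?\<phi>"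
      by (rule epimorphism_prod_map[OF topM1 topM2 D1(2) D2(2) e(2,1)])
    \<comment> \<open>Since \<open>g\<close> and \<open>h\<close> factor through
      \<open>\<phi>1\<close> and \<open>\<phi>2\<close>, equal images under the product map force
      equal values of \<open>g\<close> and \<open>h\<close>, and these determine
      \<open>f\<close>.\<close>
    have fib: "f z = f z'" if z: "z \<in> carrier_of ?M" "z' \<in> carrier_of ?M" and eq: "?\<phi> z = ?\<phi> z'" for z z'
    proof -
      obtain x y x' y' where zz: "z = e' (x, y)" "z' = e' (x', y')"
        and xy: "x \<in> carrier_of M1" "y \<in> carrier_of M2" "x' \<in> carrier_of M1" "y' \<in> carrier_of M2"
        using z by (auto simp: topspace_prod_space[OF e(2)])
      have "(\<phi>1 x, \<phi>2 y) = (\<phi>1 x', \<phi>2 y')"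
        using eq zz e by (intro injD[OF bij_is_inj[OF e(1)]]) simp
      then have "g x = g x'" "h y = h y'" using D1(3) D2(3) xy by simp_all
      from gh[rule_format, OF xy this] show ?thesis using zz by simp
    qed
    \<comment> \<open>By \<open>fib\<close> the value does not depend on the chosen preimage. On the
      carrier of \<open>?D\<close> the choice lies in the carrier of \<open>?M\<close>, which keeps
      the values of \<open>f'\<close> in \<open>A\<close>.\<close>
    define f' where "f' d = f (inv_into (carrier_of ?M) ?\<phi> d)" for d
    have im: "?\<phi> ` carrier_of ?M = carrier_of ?D" using epi by (simp add: epimorphism_def)
    have "f' ` carrier_of ?D \<subseteq> A"
    proof (rule image_subsetI)
      fix d assume "d \<in> carrier_of ?D"
      then have "inv_into (carrier_of ?M) ?\<phi> d \<in> carrier_of ?M"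
        unfolding im[symmetric] by (rule inv_into_into)
      then show "f' d \<in> A" using continuous_map_funspace[OF f] by (auto simp: f'_def)
    qed
    moreover have "f x = f' (?\<phi> x)" if x: "x \<in> carrier_of ?M" for x
      unfolding f'_def
      by (rule fib[OF x inv_into_into[OF imageI[OF x]]]) (simp only: f_inv_into_f[OF imageI[OF x]])
    moreover have "?D \<in> ?\<F>" using D1(1) D2(1) by auto
    ultimately show ?thesis using epi by blast
  qed
  have l3: "\<exists>\<psi>. isomorphism prod_lang ?M ?M \<psi> \<and> (\<forall>x\<in>carrier_of ?M. \<phi>\<^sub>2 x = \<phi>\<^sub>1 (\<psi> x))"
    if mem: "D \<in> ?\<F>" and \<phi>: "epimorphism prod_lang ?M D \<phi>\<^sub>1" "epimorphism prod_lang ?M D \<phi>\<^sub>2" for D \<phi>\<^sub>1 \<phi>\<^sub>2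
  proof -
    obtain D1 D2 where D: "D = prod_struct e D1 D2" "D1 \<in> \<F>1" "D2 \<in> \<F>2" using mem by auto
    obtain f1 f2 where f: "epimorphism L1 M1 D1 f1" "epimorphism L2 M2 D2 f2"
        "\<forall>z\<in>carrier_of ?M. \<phi>\<^sub>1 z = prod_map e' e f1 f2 z"
      using epimorphism_prod_decompose[OF topM1 topM2 top1[OF D(2)] top2[OF D(3)] e(2,1) ne \<phi>(1)[unfolded D(1)]] by blast
    obtain g1 g2 where g: "epimorphism L1 M1 D1 g1" "epimorphism L2 M2 D2 g2"
        "\<forall>z\<in>carrier_of ?M. \<phi>\<^sub>2 z = prod_map e' e g1 g2 z"
      using epimorphism_prod_decompose[OF topM1 topM2 top1[OF D(2)] top2[OF D(3)] e(2,1) ne \<phi>(2)[unfolded D(1)]] by blast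
    obtain \<psi>1 where \<psi>1: "isomorphism L1 M1 M1 \<psi>1" "\<forall>x\<in>carrier_of M1. g1 x = f1 (\<psi>1 x)"
      using projective_Fraisse_limit_homogeneous[OF M1 D(2) f(1) g(1)] by blast
    obtain \<psi>2 where \<psi>2: "isomorphism L2 M2 M2 \<psi>2" "\<forall>x\<in>carrier_of M2. g2 x = f2 (\<psi>2 x)"
      using projective_Fraisse_limit_homogeneous[OF M2 D(3) f(2) g(2)] by blast
    have iso: "isomorphism prod_lang ?M ?M (prod_map e' e' \<psi>1 \<psi>2)"
      by (rule isomorphism_prod_map[OF topM1 topM2 \<psi>1(1) \<psi>2(1) e(2)])
    have "\<phi>\<^sub>2 x = \<phi>\<^sub>1 (prod_map e' e' \<psi>1 \<psi>2 x)" if x: "x \<in> carrier_of ?M" for x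
    proof -
      obtain a b where ab: "x = e' (a, b)" "a \<in> carrier_of M1" "b \<in> carrier_of M2"
        using x by (auto simp: topspace_prod_space[OF e(2)])
      have "prod_map e' e' \<psi>1 \<psi>2 x \<in> carrier_of ?M"
        by (rule epimorphism_in_carrier[OF iso[unfolded isomorphism_def, THEN conjunct1] x])
      then show ?thesis
        using f(3) g(3) x ab \<psi>1(2) \<psi>2(2) e by simp
    qed
    then show ?thesis using iso by blast
  qed
  show ?thesis
    unfolding projective_Fraisse_limit_def
  proof (intro conjI ballI allI impI; (elim conjE)?)
    show "topological_structure prod_lang ?M"
      by (rule topological_structure_prod[OF topM1 topM2 e(2)])
  qed (rule l1 l2 l3; assumption)+
qed

lemma binary_rel_of_prod_struct:
  assumes "topological_structure L1 A" "topological_structure L2 B"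
  shows "binary_rel_of (prod_struct e A B) Both =
    {(e (a, b), e (a', b')) | a b a' b'. (a, a') \<in> binary_rel_of A R1 \<and> (b, b') \<in> binary_rel_of B R2}"
proof -
  have [simp]: "rel_arity prod_lang Both = 2" by (simp add: prod_language_def)
  have "binary_rel_of (prod_struct e A B) Both =
      (\<lambda>(s, t). (e (s 0, t 0), e (s 1, t 1))) ` (rel_of A R1 \<times> rel_of B R2)"
    by (simp add: binary_rel_of_def rel_of_prod_struct rect_def image_image split_beta
        factor_rel_def pair_tuple_def)
  then show ?thesis
    by (fastforce simp: binary_rel_of_def)
qed

end

section \<open>Representing the product of two spaces\<close>

lemma ex_bij_pair_nat_bool: "\<exists>e :: (nat \<Rightarrow> bool) \<times> (nat \<Rightarrow> bool) \<Rightarrow> nat \<Rightarrow> bool. bij e"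
proof
  \<comment> \<open>Interleaving of two sequences. Any bijection would serve, as
    \<open>prod_space\<close> transports the topology along it.\<close>
  show "bij (\<lambda>(x, y) (n::nat). if even n then x (n div 2) else y (n div 2) :: bool)"
    by (rule o_bij[where g = "\<lambda>z. (\<lambda>n. z (2 * n), \<lambda>n. z (2 * n + 1))"]) (auto simp: fun_eq_iff)
qed

lemma representable_obtain_quotient:
  assumes "representable (L :: 's language) R X"
  obtains \<F> :: "('s, nat) topstruct set" and M :: "('s, nat \<Rightarrow> bool) topstruct" and q
    where "countable \<F>" "\<forall>D\<in>\<F>. finite (carrier_of D)"
      "projective_Fraisse_family L \<F>" "projective_Fraisse_limit L \<F> M"
      "continuous_map (space_of M) X q" "q ` carrier_of M = topspace X"
      "binary_rel_of M R = {(x, y). x \<in> carrier_of M \<and> y \<in> carrier_of M \<and> q x = q y}"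
proof -
  obtain \<F> :: "('s, nat) topstruct set" and M :: "('s, nat \<Rightarrow> bool) topstruct"
    where FM: "countable \<F>" "\<forall>D\<in>\<F>. finite (carrier_of D)"
      "projective_Fraisse_family L \<F>" "projective_Fraisse_limit L \<F> M"
      "equiv (carrier_of M) (binary_rel_of M R)"
      "quotient_topology (space_of M) (binary_rel_of M R) homeomorphic_space X"
    using assms unfolding representable_def by blast
  have comp: "compact_space (space_of M)"
    using FM(4) by (simp add: projective_Fraisse_limit_def topological_structure_def)
  have haus: "Hausdorff_space X"
    using assms metrizable_imp_Hausdorff_space by (auto simp: representable_def)
  have sub: "binary_rel_of M R \<subseteq> carrier_of M \<times> carrier_of M"
    using FM(5) by (auto simp: equiv_def refl_on_def)
  from quotient_topology_homeomorphic_iff[OF comp haus sub, THEN iffD1, OF conjI[OF FM(5,6)]]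
  obtain q where "continuous_map (space_of M) X q" "q ` carrier_of M = topspace X"
      "binary_rel_of M R = {(x, y). x \<in> carrier_of M \<and> y \<in> carrier_of M \<and> q x = q y}"
    by (elim exE conjE)
  from that[OF FM(1-4) this] show thesis .
qed

text \<open>The quotient of the product limit is identified through \<open>q1 \<times> q2\<close>, a
  continuous surjection onto the product of the two spaces whose kernel is the interpretation of
  \<open>Both\<close>.\<close>

lemma representable_prod_topology:
  fixes L1 :: "'s language" and L2 :: "'t language"
  assumes X: "representable L1 R1 X" and Y: "representable L2 R2 Y"
    and relational: "fun_syms L1 = {}" "const_syms L1 = {}" "fun_syms L2 = {}" "const_syms L2 = {}"
    and ne: "topspace X \<noteq> {}" "topspace Y \<noteq> {}"
  shows "representable (prod_language L1 L2) Both (prod_topology X Y)"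
proof -
  interpret relational_pair L1 R1 L2 R2
    by standard (use X Y relational in \<open>auto simp: representable_def\<close>)
  obtain \<F>1 :: "('s, nat) topstruct set" and M1 :: "('s, nat \<Rightarrow> bool) topstruct" and q1
    where F1: "countable \<F>1" "\<forall>D\<in>\<F>1. finite (carrier_of D)"
      "projective_Fraisse_family L1 \<F>1" "projective_Fraisse_limit L1 \<F>1 M1"
      and q1: "continuous_map (space_of M1) X q1" "q1 ` carrier_of M1 = topspace X"
      "binary_rel_of M1 R1 = {(x, y). x \<in> carrier_of M1 \<and> y \<in> carrier_of M1 \<and> q1 x = q1 y}"
    by (rule representable_obtain_quotient[OF X])
  obtain \<F>2 :: "('t, nat) topstruct set" and M2 :: "('t, nat \<Rightarrow> bool) topstruct" and q2
    where F2: "countable \<F>2" "\<forall>D\<in>\<F>2. finite (carrier_of D)"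
      "projective_Fraisse_family L2 \<F>2" "projective_Fraisse_limit L2 \<F>2 M2"
      and q2: "continuous_map (space_of M2) Y q2" "q2 ` carrier_of M2 = topspace Y"
      "binary_rel_of M2 R2 = {(x, y). x \<in> carrier_of M2 \<and> y \<in> carrier_of M2 \<and> q2 x = q2 y}"
    by (rule representable_obtain_quotient[OF Y])
  obtain e' :: "(nat \<Rightarrow> bool) \<times> (nat \<Rightarrow> bool) \<Rightarrow> nat \<Rightarrow> bool" where e': "bij e'"
    using ex_bij_pair_nat_bool by blast
  \<comment> \<open>The limits are non-empty because they map onto non-empty spaces.\<close>
  have neM: "carrier_of M1 \<noteq> {}" "carrier_of M2 \<noteq> {}" using q1(2) q2(2) ne by (metis image_empty)+
  have ne1: "carrier_of D \<noteq> {}" if "D \<in> \<F>1" for D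
    by (rule projective_Fraisse_limit_nonempty[OF F1(4) that neM(1)])
  have ne2: "carrier_of D \<noteq> {}" if "D \<in> \<F>2" for D
    by (rule projective_Fraisse_limit_nonempty[OF F2(4) that neM(2)])
  have top1: "\<And>D. D \<in> \<F>1 \<Longrightarrow> topological_structure L1 D" and top2: "\<And>D. D \<in> \<F>2 \<Longrightarrow> topological_structure L2 D"
    using F1(3) F2(3) by (auto simp: projective_Fraisse_family_def)
  have topM1: "topological_structure L1 M1" and topM2: "topological_structure L2 M2"
    using F1(4) F2(4) by (auto simp: projective_Fraisse_limit_def)
  let ?\<F> = "(\<lambda>(D, E). prod_struct prod_encode D E) ` (\<F>1 \<times> \<F>2)" and ?M = "prod_struct e' M1 M2"
  have fam: "projective_Fraisse_family prod_lang ?\<F>"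
    by (rule projective_Fraisse_family_prod[OF F1(3) F2(3) ne1 ne2 bij_prod_encode])
  have lim: "projective_Fraisse_limit prod_lang ?\<F> ?M"
    by (rule projective_Fraisse_limit_prod[OF F1(4) F2(4) top1 top2 neM bij_prod_encode e'])
  have met: "metrizable_space (prod_topology X Y)" and comp: "compact_space (prod_topology X Y)"
    using X Y by (auto simp: representable_def metrizable_space_prod_topology compact_space_prod_topology)
  let ?q = "map_prod q1 q2 \<circ> inv e'"
  have q_apply: "?q (e' (a, b)) = (q1 a, q2 b)" for a b
    using e' by (simp add: bij_is_inj)
  have "continuous_map (prod_topology (space_of M1) (space_of M2)) (prod_topology X Y) (map_prod q1 q2)"
    using q1(1) q2(1) by (simp add: continuous_map_prod_top map_prod_def split_beta)
  then have q_cont: "continuous_map (space_of ?M) (prod_topology X Y) ?q"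
    using homeomorphic_maps_prod_space[OF e', of "space_of M1" "space_of M2"]
    by (auto simp: homeomorphic_maps_def intro: continuous_map_compose)
  have q_im: "?q ` carrier_of ?M = topspace (prod_topology X Y)"
  proof -
    have "?q ` carrier_of ?M = map_prod q1 q2 ` (carrier_of M1 \<times> carrier_of M2)"
      using e' by (simp only: space_of_prod_structure topspace_prod_space[OF e'] image_comp[symmetric]
          image_inv_f_f[OF bij_is_inj[OF e']])
    then show ?thesis by (simp add: map_prod_surj_on[OF q1(2) q2(2)])
  qed
  \<comment> \<open>Being related by \<open>Both\<close> means that \<open>q1\<close> identifies the
    first coordinates and \<open>q2\<close> the second, that is, that the product map identifies the
    two points.\<close>
  have q_ker: "binary_rel_of ?M Both = {(x, y). x \<in> carrier_of ?M \<and> y \<in> carrier_of ?M \<and> ?q x = ?q y}"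
  proof (rule set_eqI, clarify)
    fix x y
    obtain a b a' b' where xy: "x = e' (a, b)" "y = e' (a', b')"
      using bij_is_surj[OF e'] by (metis surjD surj_pair)
    have car: "e' (c, d) \<in> carrier_of ?M \<longleftrightarrow> c \<in> carrier_of M1 \<and> d \<in> carrier_of M2" for c d
      by (simp add: topspace_prod_space[OF e'] inj_image_mem_iff[OF bij_is_inj[OF e']])
    have "(x, y) \<in> binary_rel_of ?M Both \<longleftrightarrow> (a, a') \<in> binary_rel_of M1 R1 \<and> (b, b') \<in> binary_rel_of M2 R2"
      unfolding binary_rel_of_prod_struct[OF topM1 topM2] xy
      by (simp add: inj_eq[OF bij_is_inj[OF e']])
    also have "\<dots> \<longleftrightarrow> x \<in> carrier_of ?M \<and> y \<in> carrier_of ?M \<and> ?q x = ?q y"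
      unfolding xy car q_apply q1(3) q2(3) by auto
    finally show "(x, y) \<in> binary_rel_of ?M Both \<longleftrightarrow>
        (x, y) \<in> {(x, y). x \<in> carrier_of ?M \<and> y \<in> carrier_of ?M \<and> ?q x = ?q y}" by simp
  qed
  have quot: "equiv (carrier_of ?M) (binary_rel_of ?M Both) \<and>
      quotient_topology (space_of ?M) (binary_rel_of ?M Both) homeomorphic_space prod_topology X Y"
  proof (subst quotient_topology_homeomorphic_iff)
    show "compact_space (space_of ?M)"
      using lim by (simp add: projective_Fraisse_limit_def topological_structure_def)
    show "Hausdorff_space (prod_topology X Y)" by (rule metrizable_imp_Hausdorff_space[OF met])
    show "binary_rel_of ?M Both \<subseteq> carrier_of ?M \<times> carrier_of ?M"
      unfolding q_ker by blast
  qed (use q_cont q_im q_ker in blast)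
  have cnt: "countable ?\<F>" using F1(1) F2(1) by simp
  have fin: "\<forall>D\<in>?\<F>. finite (carrier_of D)"
    using F1(2) F2(2) by (auto simp: topspace_prod_space[OF bij_prod_encode])
  have "language prod_lang" "Both \<in> rel_syms prod_lang" "rel_arity prod_lang Both = 2"
    using X Y by (auto simp: representable_def language_def prod_language_def)
  then show ?thesis
    unfolding representable_def using cnt fin fam lim met comp quot
    by (intro conjI exI[of _ ?\<F>] exI[of _ ?M]) simp_all
qed

lemma representable_homeomorphic:
  assumes X: "representable (L :: 's language) R X" and XY: "X homeomorphic_space Y"
  shows "representable L R Y"
proof -
  obtain \<F> :: "('s, nat) topstruct set" and M :: "('s, nat \<Rightarrow> bool) topstruct"
    where "countable \<F>" "\<forall>D\<in>\<F>. finite (carrier_of D)"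
      "projective_Fraisse_family L \<F>" "projective_Fraisse_limit L \<F> M"
      "equiv (carrier_of M) (binary_rel_of M R)"
      and hom: "quotient_topology (space_of M) (binary_rel_of M R) homeomorphic_space X"
    using X unfolding representable_def by blast
  moreover have "quotient_topology (space_of M) (binary_rel_of M R) homeomorphic_space Y"
    by (rule homeomorphic_space_trans[OF hom XY])
  ultimately show ?thesis
    using X homeomorphic_compact_space[OF XY] homeomorphic_metrizable_space[OF XY]
    unfolding representable_def by (intro conjI exI[of _ \<F>] exI[of _ M]) simp_all
qed

section \<open>Finite representability and induction on the number of factors\<close>

lemma finitely_representable_homeomorphic:
  assumes "finitely_representable X" "X homeomorphic_space Y"
  shows "finitely_representable Y"
proof -
  obtain L R where L: "finite_language (L :: nat language)" "representable L R X"
    using assms(1) unfolding finitely_representable_def by blast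
  show ?thesis
    unfolding finitely_representable_def
    by (intro exI conjI) (rule L(1), rule representable_homeomorphic[OF L(2) assms(2)])
qed

lemma finitely_representable_prod_topology:
  assumes X: "finitely_representable X" and Y: "finitely_representable Y"
  shows "finitely_representable (prod_topology X Y)"
proof (cases "topspace X = {} \<or> topspace Y = {}")
  \<comment> \<open>An empty factor makes the product empty. All empty spaces are homeomorphic,
    whatever their types, so the product inherits the representation of that factor.\<close>
  case True
  then have "prod_topology X Y = trivial_topology" and "X = trivial_topology \<or> Y = trivial_topology"
    by auto
  then have "X homeomorphic_space prod_topology X Y \<or> Y homeomorphic_space prod_topology X Y"
    by (metis homeomorphic_empty_space_eq)
  then show ?thesis
    using finitely_representable_homeomorphic[OF X] finitely_representable_homeomorphic[OF Y] by (elim disjE)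
next
  case False
  obtain L1 R1 L2 R2 where L: "finite_language (L1 :: nat language)" "representable L1 R1 X"
      "finite_language (L2 :: nat language)" "representable L2 R2 Y"
    using X Y unfolding finitely_representable_def by blast
  have rep: "representable (prod_language (relational_language L1) (relational_language L2)) Both (prod_topology X Y)"
    by (rule representable_prod_topology[OF L(2,4)[THEN representable_relational_language]])
       (use False in \<open>auto simp: relational_language_def\<close>)
  \<comment> \<open>The product language is already relational, but its symbols are of type
    \<open>prodsym\<close>. A second use of the reduction renames them to naturals, as
    \<open>finitely_representable\<close> requires.\<close>
  show ?thesis
    unfolding finitely_representable_def
    by (intro exI conjI)
       (rule finite_relational_language[OF finite_prod_language[OF L(1,3)[THEN finite_relational_language]]],
        rule representable_relational_language[OF rep])
qed

text \<open>Updating at \<open>k\<close> is inverse to restricting to \<open>I\<close> and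
  evaluating at \<open>k\<close>; since \<open>k\<close> lies outside \<open>I\<close>, the update
  overwrites no coordinate. This bridges binary and indexed products in the induction.\<close>

lemma product_topology_insert_homeomorphic:
  assumes "k \<notin> I"
  shows "prod_topology (product_topology X I) (X k) homeomorphic_space product_topology X (insert k I)"
proof -
  have "continuous_map (prod_topology (product_topology X I) (X k)) (product_topology X (insert k I))
      (\<lambda>(x, y). x(k := y))"
  proof (subst continuous_map_componentwise, intro conjI ballI)
    show "(\<lambda>(x, y). x(k := y)) ` topspace (prod_topology (product_topology X I) (X k))
        \<subseteq> extensional (insert k I)"
      by (auto simp: PiE_iff extensional_def)
    fix i assume i: "i \<in> insert k I"
    show "continuous_map (prod_topology (product_topology X I) (X k)) (X i)
        (\<lambda>p. (case p of (x, y) \<Rightarrow> x(k := y)) i)"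
    proof (cases "i = k")
      case True
      then show ?thesis by (simp add: split_beta continuous_map_snd)
    next
      case False
      then have "i \<in> I" using i by simp
      from continuous_map_compose[OF continuous_map_fst continuous_map_product_projection[OF this]] False
      show ?thesis by (simp add: split_beta o_def)
    qed
  qed
  moreover have "continuous_map (product_topology X (insert k I)) (prod_topology (product_topology X I) (X k))
      (\<lambda>z. (restrict z I, z k))"
    by (intro continuous_map_pairedI)
       (auto simp: continuous_map_componentwise intro!: continuous_map_product_projection)
  ultimately have "homeomorphic_maps (prod_topology (product_topology X I) (X k))
      (product_topology X (insert k I)) (\<lambda>(x, y). x(k := y)) (\<lambda>z. (restrict z I, z k))"
    unfolding homeomorphic_maps_def using assms
    by (auto simp: fun_eq_iff PiE_iff extensional_def restrict_def)
  then show ?thesis unfolding homeomorphic_space_def by blast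
qed

theorem theorem4p3:
  fixes X :: "nat \<Rightarrow> 'a topology" and k :: nat
  assumes "k \<ge> 1"
    and "\<And>i. i \<in> {1..k} \<Longrightarrow> finitely_representable (X i)"
  shows "finitely_representable (product_topology X {1..k})"
  using assms
proof (induction k rule: nat_induct_at_least)
  case base
  \<comment> \<open>The induction starts at one factor, where the indexed product is a copy of the
    space.\<close>
  have "X 1 homeomorphic_space product_topology X {1}"
    by (rule homeomorphic_space_sym[THEN iffD1, OF homeomorphic_space_singleton_product])
  moreover have "finitely_representable (X 1)" by (rule base) simp
  ultimately show ?case
    using finitely_representable_homeomorphic by (metis atLeastAtMost_singleton)
next
  case (Suc k)
  have "finitely_representable (product_topology X {1..k})"
    by (rule Suc.IH) (rule Suc.prems, simp)
  moreover have "finitely_representable (X (Suc k))" by (rule Suc.prems) simp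
  ultimately have "finitely_representable (prod_topology (product_topology X {1..k}) (X (Suc k)))"
    by (rule finitely_representable_prod_topology)
  moreover have "prod_topology (product_topology X {1..k}) (X (Suc k)) homeomorphic_space
      product_topology X (insert (Suc k) {1..k})"
    by (rule product_topology_insert_homeomorphic) simp
  moreover have "insert (Suc k) {1..k} = {1..Suc k}" by auto
  ultimately show ?case by (metis finitely_representable_homeomorphic)
qed

end
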